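(* Let $P$ be a finite poset with $m$ elements and $w$ a labeling of $P$ such that all maximal chains of $P$ have the same number $k$ of descents with respect to $w$. Then for every $n\ge1$, $$C_n^{P,w}(x)=x^k\,A_n(x)\,h^*_{P\times[n]}(x).$$ Moreover, if $P$ is graded, then $C_n^{P,w}(x)$ is palindromic.
   Context: A labeling of $P$ is a bijection $w:P\to[m]$; it is natural if $s<t$ implies $w(s)<w(t)$. A descent of a chain $C$ of $P$ (w.r.t. $w$) is a cover relation $a<b$ in $C$ with $w(a)>w(b)$. $P$ is graded if all maximal chains have the same length. A linear extension of a labeled poset is a listing $(p_1,\dots)$ of all elements with $p_i<p_j$ implying $i<j$, identified with its word of labels; its descents are positions $i$ where the label of $p_i$ exceeds that of $p_{i+1}$, $\mathrm{des}$ is their number, and $\mathcal L(P,w)$ is the set of such words. For $j\ge0$, $\Omega_{P,w}(j)$ counts maps $\tau:P\to\{0,\dots,j\}$ with $\tau(s)\le\tau(t)$ for $s\le t$ and $\tau(s)<\tau(t)$ if moreover $s<t$ and $w(s)>w(t)$; $h^*_{P,w}$ is defined by $\sum_{j\ge0}\Omega_{P,w}(j)x^j=h^*_{P,w}(x)/(1-x)^{|P|+1}$, and $h^*_P:=h^*_{P,w}$ for natural $w$. $P\times[n]$ has the product order with the chain $[n]$; for $\sigma\in S_n$, $(w\times\sigma)(p,j)=w(p)+(\sigma(j)-1)m$. $C_n^{P,w}(x)=\sum_{\sigma\in S_n}\sum_{\pi\in\mathcal L(P\times[n],w\times\sigma)}x^{\mathrm{des}(\pi)}$. $A_n(x)=\sum_{\sigma\in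 S_n}x^{\mathrm{des}(\sigma)}$. A polynomial $f$ is palindromic if its coefficient sequence is symmetric, i.e. $x^d f(1/x)=f(x)$ for some integer $d$.
   Formalization: The poset P is assumed nonempty; for the empty poset the product formula fails when n ≥ 2, since then C_n = n! while x^k A_n(x) h* = A_n(x). *)

theory Defs
  imports
    "HOL-Library.FuncSet"
    "HOL-Computational_Algebra.Polynomial_FPS"
    "HOL-Combinatorics.Permutations"
begin

text \<open>
  A poset is given by a carrier \<open>P\<close> and its order relation \<open>r\<close> with \<open>partial_order_on P r\<close>,
  where \<open>(s, t) \<in> r\<close> means \<open>s \<le> t\<close>.
\<close>

definition labeling :: "'a set \<Rightarrow> ('a \<Rightarrow> nat) \<Rightarrow> bool" where
  "labeling P w \<longleftrightarrow> bij_betw w P {1..card P}"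

definition natural_labeling :: "'a set \<Rightarrow> 'a rel \<Rightarrow> ('a \<Rightarrow> nat) \<Rightarrow> bool" where
  "natural_labeling P r w \<longleftrightarrow>
     labeling P w \<and> (\<forall>s t. (s, t) \<in> r \<and> s \<noteq> t \<longrightarrow> w s < w t)"

definition covers :: "'a rel \<Rightarrow> 'a \<Rightarrow> 'a \<Rightarrow> bool" where
  "covers r a b \<longleftrightarrow>
     (a, b) \<in> r \<and> a \<noteq> b \<and> \<not> (\<exists>c. c \<noteq> a \<and> c \<noteq> b \<and> (a, c) \<in> r \<and> (c, b) \<in> r)"

definition maximal_chain :: "'a rel \<Rightarrow> 'a set \<Rightarrow> bool" where
  "maximal_chain r C \<longleftrightarrow> C \<in> Chains r \<and> (\<forall>D \<in> Chains r. C \<subseteq> D \<longrightarrow> D = C)"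

definition chain_descents :: "'a rel \<Rightarrow> ('a \<Rightarrow> nat) \<Rightarrow> 'a set \<Rightarrow> ('a \<times> 'a) set" where
  "chain_descents r w C = {(a, b). a \<in> C \<and> b \<in> C \<and> covers r a b \<and> w a > w b}"

definition chain_length :: "'a set \<Rightarrow> nat" where
  "chain_length C = card C - 1"

definition graded :: "'a rel \<Rightarrow> bool" where
  "graded r \<longleftrightarrow> (\<exists>l. \<forall>C. maximal_chain r C \<longrightarrow> chain_length C = l)"

definition linear_extensions :: "'a set \<Rightarrow> 'a rel \<Rightarrow> 'a list set" where
  "linear_extensions P r =
     {ps. set ps = P \<and> distinct ps \<and>
          (\<forall>i < length ps. \<forall>j < length ps.
             (ps ! i, ps ! j) \<in> r \<and> ps ! i \<noteq> ps ! j \<longrightarrow> i < j)}"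

definition linext_words :: "'a set \<Rightarrow> 'a rel \<Rightarrow> ('a \<Rightarrow> nat) \<Rightarrow> nat list set" where
  "linext_words P r w = map w ` linear_extensions P r"

definition des :: "nat list \<Rightarrow> nat" where
  "des xs = card {i. Suc i < length xs \<and> xs ! i > xs ! Suc i}"

definition Omega :: "'a set \<Rightarrow> 'a rel \<Rightarrow> ('a \<Rightarrow> nat) \<Rightarrow> nat \<Rightarrow> nat" where
  "Omega P r w j =
     card {\<tau> \<in> P \<rightarrow>\<^sub>E {0..j}.
             (\<forall>s t. (s, t) \<in> r \<longrightarrow> \<tau> s \<le> \<tau> t) \<and>
             (\<forall>s t. (s, t) \<in> r \<and> s \<noteq> t \<and> w s > w t \<longrightarrow> \<tau> s < \<tau> t)}"

text \<open>The denominator is cleared so that the defining identity lives in \<open>int fps\<close>.\<close>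

definition hstar :: "'a set \<Rightarrow> 'a rel \<Rightarrow> ('a \<Rightarrow> nat) \<Rightarrow> int poly" where
  "hstar P r w =
     (THE h. Abs_fps (\<lambda>j. int (Omega P r w j)) * (1 - fps_X) ^ (card P + 1) = fps_of_poly h)"

definition hstar_natural :: "'a set \<Rightarrow> 'a rel \<Rightarrow> int poly" where
  "hstar_natural P r = hstar P r (SOME w. natural_labeling P r w)"

lemma Omega_natural:
  assumes "natural_labeling P r w"
  shows "Omega P r w j = card {\<tau> \<in> P \<rightarrow>\<^sub>E {0..j}. \<forall>s t. (s, t) \<in> r \<longrightarrow> \<tau> s \<le> \<tau> t}"
proof -
  have "\<not> ((s, t) \<in> r \<and> s \<noteq> t \<and> w s > w t)" for s t
    using assms unfolding natural_labeling_def by (meson less_asym)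
  then show ?thesis
    unfolding Omega_def by (intro arg_cong[where f = card] Collect_cong) blast
qed

lemma hstar_natural_eq:
  assumes "natural_labeling P r w"
  shows "hstar_natural P r = hstar P r w"
proof -
  have "natural_labeling P r (SOME w. natural_labeling P r w)"
    using someI[of "natural_labeling P r" w] assms by simp
  then show ?thesis
    unfolding hstar_natural_def hstar_def by (simp add: Omega_natural assms)
qed

definition prod_chain_rel :: "'a rel \<Rightarrow> nat \<Rightarrow> ('a \<times> nat) rel" where
  "prod_chain_rel r n =
     {((p, i), (q, j)). (p, q) \<in> r \<and> i \<in> {1..n} \<and> j \<in> {1..n} \<and> i \<le> j}"

definition prod_labeling ::
    "'a set \<Rightarrow> ('a \<Rightarrow> nat) \<Rightarrow> (nat \<Rightarrow> nat) \<Rightarrow> 'a \<times> nat \<Rightarrow> nat" where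
  "prod_labeling P w \<sigma> = (\<lambda>(p, j). w p + (\<sigma> j - 1) * card P)"

definition C_poly :: "'a set \<Rightarrow> 'a rel \<Rightarrow> ('a \<Rightarrow> nat) \<Rightarrow> nat \<Rightarrow> int poly" where
  "C_poly P r w n =
     (\<Sum>\<sigma> | \<sigma> permutes {1..n}.
        \<Sum>\<pi> \<in> linext_words (P \<times> {1..n}) (prod_chain_rel r n) (prod_labeling P w \<sigma>).
          monom 1 (des \<pi>))"

definition A_poly :: "nat \<Rightarrow> int poly" where
  "A_poly n = (\<Sum>\<sigma> | \<sigma> permutes {1..n}. monom 1 (des (map \<sigma> [1..<n + 1])))"

text \<open>
  A negative exponent \<open>d\<close> in \<open>x\<^sup>d f(1/x) = f(x)\<close> is possible only for \<open>f = 0\<close>,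
  so natural \<open>d\<close> suffices.
\<close>

definition palindromic :: "'a::zero poly \<Rightarrow> bool" where
  "palindromic f \<longleftrightarrow>
     (\<exists>d::nat. degree f \<le> d \<and> (\<forall>i \<le> d. coeff f i = coeff f (d - i)))"

end

theory Submission
  imports Defs
begin

text \<open>
  The polynomial \<open>\<Sum>\<pi>. x ^ des \<pi>\<close> over the linear extensions of a labeled poset is its \<open>h\<^sup>*\<close>-polynomial:
  in a \<open>(P, w)\<close>-partition \<open>\<tau>\<close>, remove the element with lexicographically greatest \<open>(\<tau> p, w p)\<close>, which
  is the last element of the linear extension that \<open>\<tau>\<close> determines.

  If all maximal chains have \<open>k\<close> descents, then any two maximal chains through \<open>p\<close> have the same
  number \<open>\<delta> p\<close> of descents below \<open>p\<close>, since their lower and upper halves can be exchanged.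
  Subtracting from \<open>\<tau> (p, i)\<close> the number \<open>\<delta> p\<close> plus the number of descents of \<open>\<sigma>\<close> before \<open>i\<close> turns
  the partitions of \<open>(P \<times> [n], w \<times> \<sigma>)\<close> bounded by \<open>j\<close> into the order-preserving maps bounded by
  \<open>j - k - des \<sigma>\<close>, so the \<open>h\<^sup>*\<close>-polynomial of \<open>w \<times> \<sigma>\<close> is \<open>x ^ (k + des \<sigma>)\<close> times that of a
  natural labeling. Summing over \<open>\<sigma>\<close> gives the product formula.

  Complementing all labels exchanges descents and ascents of linear extensions, hence reverses
  \<open>C_poly\<close>. If \<open>P\<close> is graded of length \<open>l\<close>, the complementary labeling has \<open>l - k\<close> descents on every
  maximal chain, so by the product formula the reversed polynomial is \<open>C_poly\<close> up to a power of \<open>x\<close>.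
\<close>

subsection \<open>Linear extensions and \<open>(P, w)\<close>-partitions\<close>

text \<open>The bound is on the pair \<open>(\<tau> s, v s)\<close> in the lexicographic order, which makes the recursion
  below close: what remains after removing the greatest element \<open>p\<close> is bounded by \<open>(\<tau> p, v p)\<close>.\<close>

definition ppartitions ::
    "'a set \<Rightarrow> 'a rel \<Rightarrow> ('a \<Rightarrow> nat) \<Rightarrow> nat \<Rightarrow> nat \<Rightarrow> ('a \<Rightarrow> nat) set" where
  "ppartitions Q r v j b =
     {\<tau> \<in> Q \<rightarrow>\<^sub>E UNIV.
        (\<forall>s\<in>Q. \<forall>t\<in>Q. (s, t) \<in> r \<longrightarrow> s \<noteq> t \<longrightarrow> \<tau> s < \<tau> t \<or> \<tau> s = \<tau> t \<and> v s \<le> v t) \<and>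
        (\<forall>s\<in>Q. \<tau> s < j \<or> \<tau> s = j \<and> v s \<le> b)}"

definition maximal_elements :: "'a set \<Rightarrow> 'a rel \<Rightarrow> 'a set" where
  "maximal_elements Q r = {p \<in> Q. \<forall>q\<in>Q. (p, q) \<in> r \<longrightarrow> q = p}"

lemma finite_ppartitions:
  assumes "finite Q"
  shows "finite (ppartitions Q r v j b)"
proof (rule finite_subset)
  show "ppartitions Q r v j b \<subseteq> Q \<rightarrow>\<^sub>E {..j}"
    unfolding ppartitions_def by (fastforce simp: PiE_iff)
  show "finite (Q \<rightarrow>\<^sub>E {..j})"
    using assms by (intro finite_PiE) auto
qed

lemma finite_maximal_elements: "finite Q \<Longrightarrow> finite (maximal_elements Q r)"
  unfolding maximal_elements_def by simp

lemma ex_lex_greatest: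
  fixes f g :: "'a \<Rightarrow> nat"
  assumes "finite Q" "Q \<noteq> {}"
  shows "\<exists>p\<in>Q. \<forall>q\<in>Q. f q < f p \<or> f q = f p \<and> g q \<le> g p"
  using assms
proof (induction Q rule: finite_ne_induct)
  case (insert x F)
  then obtain p where p: "p \<in> F" "\<forall>q\<in>F. f q < f p \<or> f q = f p \<and> g q \<le> g p" by blast
  show ?case
  proof (cases "f x < f p \<or> f x = f p \<and> g x \<le> g p")
    case True
    then show ?thesis using p by (intro bexI[of _ p]) auto
  next
    case False
    then have "f p < f x \<or> f p = f x \<and> g p \<le> g x" by linarith
    then have "f q < f x \<or> f q = f x \<and> g q \<le> g x" if "q \<in> F" for q
      using bspec[OF p(2) that] by linarith
    then show ?thesis by auto
  qed
qed simp

text \<open>Injectivity of \<open>v\<close> makes the element with lexicographically greatest pair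
  \<open>(\<tau> p, v p)\<close> unique, and the order condition makes it maximal in
  \<open>Q\<close>. The triple records this element, its value and the rest; the bound
  \<open>(a, v p)\<close> on the rest says exactly that \<open>p\<close> was the greatest.\<close>

lemma ppartitions_remove_greatest:
  assumes "finite Q" "Q \<noteq> {}" "inj_on v Q"
  shows "bij_betw (\<lambda>(p, a, \<tau>). \<tau>(p := a))
           (SIGMA p : maximal_elements Q r. SIGMA a : {a. a < j \<or> a = j \<and> v p \<le> b}.
              ppartitions (Q - {p}) r v a (v p))
           (ppartitions Q r v j b)" (is "bij_betw ?f ?A ?B")
proof (rule bij_betw_imageI)
  show "inj_on ?f ?A"
  proof (rule inj_onI)
    fix x y assume x: "x \<in> ?A" and y: "y \<in> ?A" and eq: "?f x = ?f y"
    obtain p a \<tau> where X: "x = (p, a, \<tau>)" by (cases x)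
    obtain q c \<rho> where Y: "y = (q, c, \<rho>)" by (cases y)
    have e: "\<tau>(p := a) = \<rho>(q := c)" using eq X Y by simp
    have pq: "p \<in> Q" "q \<in> Q" using x y X Y by (simp_all add: maximal_elements_def)
    have \<tau>: "\<tau> \<in> ppartitions (Q - {p}) r v a (v p)" and \<rho>: "\<rho> \<in> ppartitions (Q - {q}) r v c (v q)"
      using x y X Y by simp_all
    \<comment> \<open>Otherwise \<open>p\<close> and \<open>q\<close> would both be
      lexicographically greatest for the same map, forcing equal labels.\<close>
    have "q = p"
    proof (rule ccontr)
      assume n: "q \<noteq> p"
      have "\<tau> q = c" "\<rho> p = a" using fun_cong[OF e, of q] fun_cong[OF e, of p] n by simp_all
      moreover have "\<tau> q < a \<or> \<tau> q = a \<and> v q \<le> v p"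
        using \<tau> pq n by (simp add: ppartitions_def)
      moreover have "\<rho> p < c \<or> \<rho> p = c \<and> v p \<le> v q"
        using \<rho> pq n by (simp add: ppartitions_def)
      ultimately have "v p = v q" by linarith
      then show False using inj_onD[OF assms(3)] pq n by metis
    qed
    moreover have "a = c" using fun_cong[OF e, of p] calculation by simp
    moreover have "\<tau> = \<rho>"
    proof
      fix z
      \<comment> \<open>Away from \<open>p\<close> the two rests agree by \<open>e\<close>; at
        \<open>p\<close> both take the default value, since \<open>p\<close> was removed from their
        domain.\<close>
      have "\<tau> p = undefined" "\<rho> p = undefined"
        using \<tau> \<rho> \<open>q = p\<close> by (simp_all add: ppartitions_def PiE_iff extensional_def)
      then show "\<tau> z = \<rho> z" using fun_cong[OF e, of z] \<open>q = p\<close> by (cases "z = p") simp_all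
    qed
    ultimately show "x = y" using X Y by simp
  qed
  show "?f ` ?A = ?B"
  proof (intro equalityI subsetI)
    fix \<tau> assume "\<tau> \<in> ?f ` ?A"
    then obtain p a \<rho> where \<tau>: "\<tau> = \<rho>(p := a)" and p: "p \<in> maximal_elements Q r"
      and a: "a < j \<or> a = j \<and> v p \<le> b" and \<rho>: "\<rho> \<in> ppartitions (Q - {p}) r v a (v p)" by auto
    have pQ: "p \<in> Q" and pmax: "\<And>q. q \<in> Q \<Longrightarrow> (p, q) \<in> r \<Longrightarrow> q = p"
      using p by (simp_all add: maximal_elements_def)
    have 1: "\<rho> s < a \<or> \<rho> s = a \<and> v s \<le> v p" if "s \<in> Q" "s \<noteq> p" for s
      using \<rho> that by (simp add: ppartitions_def)
    have 2: "\<rho> s < \<rho> t \<or> \<rho> s = \<rho> t \<and> v s \<le> v t"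
      if "s \<in> Q" "t \<in> Q" "s \<noteq> p" "t \<noteq> p" "(s, t) \<in> r" "s \<noteq> t" for s t
      using \<rho> that by (simp add: ppartitions_def)
    have "\<tau> s < \<tau> t \<or> \<tau> s = \<tau> t \<and> v s \<le> v t"
      if "s \<in> Q" "t \<in> Q" "(s, t) \<in> r" "s \<noteq> t" for s t
    proof -
      have "s \<noteq> p" using pmax[of t] that by blast
      then show ?thesis using 1[of s] 2[of s t] that \<tau> by (cases "t = p") simp_all
    qed
    moreover have "\<tau> s < j \<or> \<tau> s = j \<and> v s \<le> b" if "s \<in> Q" for s
    proof (cases "s = p")
      case False
      then show ?thesis using 1[OF that] a \<tau> by auto
    qed (use a \<tau> in simp)
    moreover have "\<tau> \<in> Q \<rightarrow>\<^sub>E UNIV"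
      using \<rho> pQ \<tau> by (simp add: ppartitions_def PiE_iff extensional_def)
    ultimately show "\<tau> \<in> ?B" by (simp add: ppartitions_def)
  next
    fix \<tau> assume \<tau>: "\<tau> \<in> ?B"
    obtain p where p: "p \<in> Q" "\<And>q. q \<in> Q \<Longrightarrow> \<tau> q < \<tau> p \<or> \<tau> q = \<tau> p \<and> v q \<le> v p"
      using ex_lex_greatest[OF assms(1,2), of \<tau> v] by blast
    have "q = p" if "q \<in> Q" "(p, q) \<in> r" for q
    proof (rule ccontr)
      assume "q \<noteq> p"
      then have "\<tau> p < \<tau> q \<or> \<tau> p = \<tau> q \<and> v p \<le> v q"
        using \<tau> p(1) that by (simp add: ppartitions_def)
      then have "v p = v q" using p(2)[OF that(1)] by linarith
      then show False using inj_onD[OF assms(3)] p(1) that(1) \<open>q \<noteq> p\<close> by metis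
    qed
    then have 1: "p \<in> maximal_elements Q r" using p(1) by (simp add: maximal_elements_def)
    have 2: "\<tau> p < j \<or> \<tau> p = j \<and> v p \<le> b" using \<tau> p(1) by (simp add: ppartitions_def)
    have 3: "\<tau>(p := undefined) \<in> ppartitions (Q - {p}) r v (\<tau> p) (v p)"
      using \<tau> p by (simp add: ppartitions_def PiE_iff extensional_def)
    show "\<tau> \<in> ?f ` ?A"
      by (rule image_eqI[of _ _ "(p, \<tau> p, \<tau>(p := undefined))"]) (use 1 2 3 in simp_all)
  qed
qed

lemma card_ppartitions_rec:
  assumes "finite Q" "Q \<noteq> {}" "inj_on v Q"
  shows "card (ppartitions Q r v j b) =
    (\<Sum>p\<in>maximal_elements Q r. \<Sum>a | a < j \<or> a = j \<and> v p \<le> b.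
       card (ppartitions (Q - {p}) r v a (v p)))"
proof -
  have fin: "finite {a. a < j \<or> a = j \<and> v p \<le> b}" for p
    by (rule finite_subset[of _ "{..j}"]) auto
  show ?thesis
    unfolding bij_betw_same_card[OF ppartitions_remove_greatest[OF assms], symmetric]
    using assms(1) fin
    by (simp add: card_SigmaI finite_maximal_elements finite_ppartitions)
qed

section \<open>Linear extensions, peeled from the last element\<close>

lemma linear_extensions_iff:
  "ps \<in> linear_extensions Q r \<longleftrightarrow>
     set ps = Q \<and> distinct ps \<and> sorted_wrt (\<lambda>x y. (y, x) \<notin> r) ps"
proof -
  have "(\<forall>i < length ps. \<forall>j < length ps. (ps ! i, ps ! j) \<in> r \<and> ps ! i \<noteq> ps ! j \<longrightarrow> i < j)
      \<longleftrightarrow> sorted_wrt (\<lambda>x y. (y, x) \<notin> r) ps" if "distinct ps"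
  proof (intro iffI allI impI)
    assume *: "\<forall>i < length ps. \<forall>j < length ps. (ps ! i, ps ! j) \<in> r \<and> ps ! i \<noteq> ps ! j \<longrightarrow> i < j"
    show "sorted_wrt (\<lambda>x y. (y, x) \<notin> r) ps"
      unfolding sorted_wrt_iff_nth_less
    proof (intro allI impI notI)
      fix i j assume "i < j" "j < length ps" "(ps ! j, ps ! i) \<in> r"
      moreover from this have "ps ! j \<noteq> ps ! i" using that by (simp add: nth_eq_iff_index_eq)
      ultimately have "j < i" using * by simp
      then show False using \<open>i < j\<close> by simp
    qed
  next
    fix i j
    assume *: "sorted_wrt (\<lambda>x y. (y, x) \<notin> r) ps" and ij: "i < length ps" "j < length ps"
      "(ps ! i, ps ! j) \<in> r \<and> ps ! i \<noteq> ps ! j"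
    show "i < j"
    proof (rule ccontr)
      assume "\<not> i < j"
      moreover have "i \<noteq> j" using ij by auto
      ultimately have "j < i" by simp
      then show False using * ij by (auto simp: sorted_wrt_iff_nth_less)
    qed
  qed
  then show ?thesis unfolding linear_extensions_def by blast
qed

lemma linear_extensions_snoc:
  assumes "Q \<noteq> {}"
  shows "linear_extensions Q r =
    (\<Union>p\<in>maximal_elements Q r. (\<lambda>ps. ps @ [p]) ` linear_extensions (Q - {p}) r)"
proof (intro equalityI subsetI)
  fix ps assume ps: "ps \<in> linear_extensions Q r"
  then have "ps \<noteq> []" using assms by (auto simp: linear_extensions_iff)
  then obtain qs p where eq: "ps = qs @ [p]" by (metis rev_exhaust)
  have "p \<in> maximal_elements Q r" "qs \<in> linear_extensions (Q - {p}) r"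
    using ps by (auto simp: eq linear_extensions_iff sorted_wrt_append maximal_elements_def)
  then show "ps \<in> (\<Union>p\<in>maximal_elements Q r. (\<lambda>ps. ps @ [p]) ` linear_extensions (Q - {p}) r)"
    using eq by auto
next
  fix ps assume "ps \<in> (\<Union>p\<in>maximal_elements Q r. (\<lambda>ps. ps @ [p]) ` linear_extensions (Q - {p}) r)"
  then show "ps \<in> linear_extensions Q r"
    by (auto simp: linear_extensions_iff sorted_wrt_append maximal_elements_def)
qed

lemma finite_linear_extensions:
  assumes "finite Q"
  shows "finite (linear_extensions Q r)"
  by (rule finite_subset[OF _ finite_subset_distinct])
     (use assms in \<open>auto simp: linear_extensions_def\<close>)

lemma des_snoc2: "des (xs @ [x, y]) = des (xs @ [x]) + (if y < x then 1 else 0)"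
proof -
  let ?D = "\<lambda>xs :: nat list. {i. Suc i < length xs \<and> xs ! Suc i < xs ! i}"
  have "?D (xs @ [x, y]) = ?D (xs @ [x]) \<union> (if y < x then {length xs} else {})"
    by (auto simp: nth_append less_Suc_eq split: if_splits)
  moreover have "finite (?D (xs @ [x]))" by simp
  moreover have "length xs \<notin> ?D (xs @ [x])" by simp
  ultimately show ?thesis unfolding des_def by simp
qed

text \<open>The appended letter \<open>b\<close> is a sentinel. Removing the last element
  \<open>p\<close> makes \<open>v p\<close> the sentinel of the rest, and only the possible descent
  from \<open>v p\<close> to \<open>b\<close> is lost.\<close>

lemma sum_linear_extensions_rec:
  fixes v :: "'a \<Rightarrow> nat"
  assumes "finite Q" "Q \<noteq> {}"
  shows "(\<Sum>ps\<in>linear_extensions Q r. monom 1 (des (map v ps @ [b])) :: int poly) =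
    (\<Sum>p\<in>maximal_elements Q r. monom 1 (if b < v p then 1 else 0) *
       (\<Sum>ps\<in>linear_extensions (Q - {p}) r. monom 1 (des (map v ps @ [v p]))))"
proof -
  have "(\<Sum>ps\<in>linear_extensions Q r. monom 1 (des (map v ps @ [b])) :: int poly) =
    (\<Sum>p\<in>maximal_elements Q r. \<Sum>ps\<in>(\<lambda>ps. ps @ [p]) ` linear_extensions (Q - {p}) r.
       monom 1 (des (map v ps @ [b])))"
    unfolding linear_extensions_snoc[OF assms(2)]
    by (rule sum.UNION_disjoint) (auto simp: assms finite_maximal_elements finite_linear_extensions)
  also have "\<dots> = (\<Sum>p\<in>maximal_elements Q r. \<Sum>ps\<in>linear_extensions (Q - {p}) r.
       monom 1 (des (map v ps @ [v p, b])))"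
    by (simp add: sum.reindex inj_on_def)
  also have "\<dots> = (\<Sum>p\<in>maximal_elements Q r. monom 1 (if b < v p then 1 else 0) *
       (\<Sum>ps\<in>linear_extensions (Q - {p}) r. monom 1 (des (map v ps @ [v p]))))"
    by (simp add: des_snoc2 sum_distrib_left mult_monom add.commute)
  finally show ?thesis .
qed

text \<open>Induction on the size of \<open>Q\<close>: both sides obey the same recursion over the
  removed element \<open>p\<close>. Multiplying by \<open>1 - fps_X\<close> takes differences in
  \<open>j\<close>, which reduces the sum over the value of \<open>p\<close> to one term; that term
  is shifted by \<open>fps_X\<close> exactly when \<open>b < v p\<close>, as a final descent
  demands.\<close>

lemma ppartitions_gf:
  assumes "finite Q" "inj_on v Q"
  shows "Abs_fps (\<lambda>j. int (card (ppartitions Q r v j b))) * (1 - fps_X) ^ (card Q + 1) =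
    fps_of_poly (\<Sum>ps\<in>linear_extensions Q r. monom 1 (des (map v ps @ [b])))"
  using assms
proof (induction "card Q" arbitrary: Q b)
  case 0
  then have Q: "Q = {}" by simp
  have "ppartitions Q r v j b = {\<lambda>_. undefined}" for j
    by (auto simp: Q ppartitions_def)
  moreover have "linear_extensions Q r = {[]}" by (auto simp: Q linear_extensions_iff)
  moreover have "des [b] = 0" by (simp add: des_def)
  \<comment> \<open>With nothing to label there is one partition for every \<open>j\<close>, and the
    all-ones series is the inverse of \<open>1 - fps_X\<close>.\<close>
  moreover have "Abs_fps (\<lambda>j. 1 :: int) * (1 - fps_X) = 1"
    by (rule fps_ext) (auto simp: right_diff_distrib fps_X_mult_right_nth)
  ultimately show ?case by (simp add: Q)
next
  case (Suc n)
  have ne: "Q \<noteq> {}" using Suc.hyps(2) by auto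
  let ?M = "maximal_elements Q r"
  let ?F = "\<lambda>Q b. Abs_fps (\<lambda>j. int (card (ppartitions Q r v j b)))"
  let ?e = "\<lambda>p. if b < v p then 1 else 0 :: nat"
  have IH: "?F (Q - {p}) (v p) * (1 - fps_X) ^ card Q =
      fps_of_poly (\<Sum>ps\<in>linear_extensions (Q - {p}) r. monom 1 (des (map v ps @ [v p])))"
    if "p \<in> ?M" for p
  proof -
    have p: "p \<in> Q" using that by (simp add: maximal_elements_def)
    have c: "n = card (Q - {p})" using Suc p by simp
    have "card Q = card (Q - {p}) + 1" using Suc p by simp
    then show ?thesis
      using Suc.hyps(1)[OF c, of "v p"] Suc.prems by (auto simp: inj_on_diff)
  qed
  have step: "?F Q b * (1 - fps_X) = (\<Sum>p\<in>?M. fps_X ^ ?e p * ?F (Q - {p}) (v p))"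
  proof (rule fps_ext)
    fix j
    let ?S = "\<lambda>p j. \<Sum>a | a < j \<or> a = j \<and> v p \<le> b. int (card (ppartitions (Q - {p}) r v a (v p)))"
    have F: "int (card (ppartitions Q r v j b)) = (\<Sum>p\<in>?M. ?S p j)" for j
      using card_ppartitions_rec[OF Suc.prems(1) ne Suc.prems(2), of r j b] by simp
    \<comment> \<open>The value \<open>a\<close> runs over \<open>a < j\<close> if
      \<open>b < v p\<close> and over \<open>a \<le> j\<close> otherwise, so passing from
      \<open>j - 1\<close> to \<open>j\<close> adds the term at \<open>j - 1\<close> or at
      \<open>j\<close>; this is the exponent \<open>?e p\<close>.\<close>
    have S: "?S p j = (if j = 0 then 0 else ?S p (j - 1)) + fps_nth (fps_X ^ ?e p * ?F (Q - {p}) (v p)) j" for p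
    proof (cases "b < v p")
      case True
      then have *: "{a. a < j \<or> a = j \<and> v p \<le> b} = {..<j}" for j :: nat by auto
      show ?thesis unfolding * using True by (cases j) auto
    next
      case False
      then have *: "{a. a < j \<or> a = j \<and> v p \<le> b} = {..j}" for j :: nat by auto
      show ?thesis unfolding * using False by (cases j) auto
    qed
    have "fps_nth (?F Q b * (1 - fps_X)) j =
        (\<Sum>p\<in>?M. ?S p j) - (if j = 0 then 0 else \<Sum>p\<in>?M. ?S p (j - 1))"
      by (simp add: right_diff_distrib fps_X_mult_right_nth F)
    also have "\<dots> = fps_nth (\<Sum>p\<in>?M. fps_X ^ ?e p * ?F (Q - {p}) (v p)) j"
      by (subst S) (simp add: sum.distrib fps_sum_nth)
    finally show "fps_nth (?F Q b * (1 - fps_X)) j =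
        fps_nth (\<Sum>p\<in>?M. fps_X ^ ?e p * ?F (Q - {p}) (v p)) j" .
  qed
  have "?F Q b * (1 - fps_X) ^ (card Q + 1) =
      (\<Sum>p\<in>?M. fps_X ^ ?e p * (?F (Q - {p}) (v p) * (1 - fps_X) ^ card Q))"
    using step by (simp add: mult.assoc[symmetric] sum_distrib_right)
  also have "\<dots> = fps_of_poly (\<Sum>p\<in>?M. monom 1 (?e p) *
      (\<Sum>ps\<in>linear_extensions (Q - {p}) r. monom 1 (des (map v ps @ [v p]))))"
    by (simp add: IH fps_of_poly_sum fps_of_poly_mult fps_of_poly_monom)
  finally show ?case
    by (simp only: sum_linear_extensions_rec[OF Suc.prems(1) ne])
qed

text \<open>Once \<open>b\<close> dominates all labels, the lexicographic bound by
  \<open>(j, b)\<close> reduces to the bound by \<open>j\<close> on values, and the sentinel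
  \<open>b\<close> creates no descent.\<close>

lemma Omega_gf:
  assumes "finite P" "r \<subseteq> P \<times> P" "inj_on v P"
  shows "Abs_fps (\<lambda>j. int (Omega P r v j)) * (1 - fps_X) ^ (card P + 1) =
    fps_of_poly (\<Sum>\<pi>\<in>linext_words P r v. monom 1 (des \<pi>))"
proof -
  \<comment> \<open>Inserting 0 keeps \<open>Max\<close> meaningful when \<open>P\<close> is
    empty.\<close>
  define b where "b = Max (insert 0 (v ` P))"
  have b: "v p \<le> b" if "p \<in> P" for p using that assms(1) by (simp add: b_def)
  have "{\<tau> \<in> P \<rightarrow>\<^sub>E {0..j}. (\<forall>s t. (s, t) \<in> r \<longrightarrow> \<tau> s \<le> \<tau> t) \<and>
      (\<forall>s t. (s, t) \<in> r \<and> s \<noteq> t \<and> v s > v t \<longrightarrow> \<tau> s < \<tau> t)} = ppartitions P r v j b" for j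
  proof (intro equalityI subsetI)
    fix \<tau> assume "\<tau> \<in> ppartitions P r v j b"
    then have 1: "\<tau> \<in> P \<rightarrow>\<^sub>E UNIV" and 2: "\<And>s. s \<in> P \<Longrightarrow> \<tau> s \<le> j"
      and 3: "\<And>s t. (s, t) \<in> r \<Longrightarrow> s \<noteq> t \<Longrightarrow> \<tau> s < \<tau> t \<or> \<tau> s = \<tau> t \<and> v s \<le> v t"
      using assms(2) by (fastforce simp: ppartitions_def)+
    have "\<tau> s \<le> \<tau> t" if "(s, t) \<in> r" for s t using 3[of s t] that by (cases "s = t") auto
    moreover have "\<tau> s < \<tau> t" if "(s, t) \<in> r" "s \<noteq> t" "v s > v t" for s t
      using 3[of s t] that by simp
    ultimately show "\<tau> \<in> {\<tau> \<in> P \<rightarrow>\<^sub>E {0..j}. (\<forall>s t. (s, t) \<in> r \<longrightarrow> \<tau> s \<le> \<tau> t) \<and>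
      (\<forall>s t. (s, t) \<in> r \<and> s \<noteq> t \<and> v s > v t \<longrightarrow> \<tau> s < \<tau> t)}"
      using 1 2 by (simp add: PiE_iff)
  next
    fix \<tau> assume \<tau>: "\<tau> \<in> {\<tau> \<in> P \<rightarrow>\<^sub>E {0..j}. (\<forall>s t. (s, t) \<in> r \<longrightarrow> \<tau> s \<le> \<tau> t) \<and>
      (\<forall>s t. (s, t) \<in> r \<and> s \<noteq> t \<and> v s > v t \<longrightarrow> \<tau> s < \<tau> t)}"
    have "\<tau> s < \<tau> t \<or> \<tau> s = \<tau> t \<and> v s \<le> v t" if "(s, t) \<in> r" "s \<noteq> t" for s t
    proof -
      have "\<tau> s \<le> \<tau> t" "v s > v t \<longrightarrow> \<tau> s < \<tau> t" using \<tau> that by simp_all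
      then show ?thesis by linarith
    qed
    moreover have "\<tau> s < j \<or> \<tau> s = j \<and> v s \<le> b" if "s \<in> P" for s
    proof -
      have "\<tau> s \<le> j" using \<tau> that by (auto simp: PiE_iff)
      then show ?thesis using b[OF that] by auto
    qed
    ultimately show "\<tau> \<in> ppartitions P r v j b" using \<tau> by (simp add: ppartitions_def PiE_iff)
  qed
  then have "Omega P r v j = card (ppartitions P r v j b)" for j by (simp add: Omega_def)
  moreover have "des (map v ps @ [b]) = des (map v ps)" if "ps \<in> linear_extensions P r" for ps
  proof (cases ps rule: rev_cases)
    case Nil
    then show ?thesis by (simp add: des_def)
  next
    case (snoc qs q)
    then have "v q \<le> b" using b that by (auto simp: linear_extensions_iff)
    then show ?thesis using snoc des_snoc2[of "map v qs" "v q" b] by simp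
  qed
  moreover have "inj_on (map v) (linear_extensions P r)"
    using assms(3) by (intro inj_on_mapI) (auto simp: linear_extensions_iff)
  ultimately show ?thesis
    using ppartitions_gf[OF assms(1,3), of r b] by (simp add: linext_words_def sum.reindex)
qed

text \<open>Injectivity of \<open>fps_of_poly\<close> gives the uniqueness that the definite
  description asks for.\<close>

lemma hstar_eqI:
  assumes "Abs_fps (\<lambda>j. int (Omega P r v j)) * (1 - fps_X) ^ (card P + 1) = fps_of_poly h"
  shows "hstar P r v = h"
  unfolding hstar_def using assms by (intro the_equality) (auto simp: fps_of_poly_eq_iff)

lemma hstar_gf:
  assumes "finite P" "r \<subseteq> P \<times> P" "inj_on v P"
  shows "Abs_fps (\<lambda>j. int (Omega P r v j)) * (1 - fps_X) ^ (card P + 1) = fps_of_poly (hstar P r v)"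
  and "hstar P r v = (\<Sum>\<pi>\<in>linext_words P r v. monom 1 (des \<pi>))"
  using Omega_gf[OF assms] hstar_eqI[OF Omega_gf[OF assms]] by simp_all

subsection \<open>Maximal chains of finite posets\<close>

locale finite_poset =
  fixes P :: "'a set" and r :: "'a rel"
  assumes finite_carrier: "finite P" and order: "partial_order_on P r"
begin

lemma rel_subset: "r \<subseteq> P \<times> P"
  using order by (rule partial_order_onD)

lemma rel_carrier: "(a, b) \<in> r \<Longrightarrow> a \<in> P \<and> b \<in> P"
  using rel_subset by blast

lemma rel_refl: "a \<in> P \<Longrightarrow> (a, a) \<in> r"
  using partial_order_onD(1)[OF order] by (simp add: refl_on_def)

lemma rel_trans: "(a, b) \<in> r \<Longrightarrow> (b, c) \<in> r \<Longrightarrow> (a, c) \<in> r"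
  using partial_order_onD(2)[OF order] by (rule transD)

lemma rel_antisym: "(a, b) \<in> r \<Longrightarrow> (b, a) \<in> r \<Longrightarrow> a = b"
  using partial_order_onD(3)[OF order] by (rule antisymD)

text \<open>Order duality: facts about minimal elements transfer to maximal ones.\<close>

lemma finite_poset_converse: "finite_poset P (r\<inverse>)"
  using finite_carrier order by unfold_locales simp_all

lemma ex_minimal:
  assumes "A \<subseteq> P" "A \<noteq> {}"
  shows "\<exists>p\<in>A. \<forall>q\<in>A. (q, p) \<in> r \<longrightarrow> q = p"
proof -
  have "finite r" using rel_subset finite_carrier by (meson finite_SigmaI finite_subset)
  then have "wf (r - Id)" using order by (rule partial_order_on_well_order_on)
  moreover obtain a where "a \<in> A" using assms(2) by blast
  ultimately obtain p where "p \<in> A" "\<And>q. (q, p) \<in> r - Id \<Longrightarrow> q \<notin> A"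
    by (rule wfE_min) blast
  then show ?thesis by blast
qed

lemma ex_minimal_below:
  assumes "p \<in> P"
  shows "\<exists>q. (q, p) \<in> r \<and> (\<forall>s. (s, q) \<in> r \<longrightarrow> s = q)"
proof -
  obtain q where "(q, p) \<in> r" "\<And>s. (s, p) \<in> r \<Longrightarrow> (s, q) \<in> r \<Longrightarrow> s = q"
    using ex_minimal[of "{q. (q, p) \<in> r}"] rel_carrier rel_refl[OF assms] by auto
  then show ?thesis using rel_trans by blast
qed

text \<open>Every relation is refined to a saturated chain: if \<open>a < b\<close> is not a cover,
  an element strictly between splits the interval into two strictly smaller ones.\<close>

lemma cover_induct:
  assumes "(a, b) \<in> r"
    and "\<And>a. R a a"
    and "\<And>a b. covers r a b \<Longrightarrow> R a b"
    and "\<And>a b c. R a b \<Longrightarrow> R b c \<Longrightarrow> R a c"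
  shows "R a b"
  using assms(1)
proof (induction "card {c. (a, c) \<in> r \<and> (c, b) \<in> r}" arbitrary: a b rule: less_induct)
  case less
  let ?I = "\<lambda>a b. {c. (a, c) \<in> r \<and> (c, b) \<in> r}"
  have fin: "finite (?I a b)"
    by (rule finite_subset[OF _ finite_carrier]) (use rel_carrier in auto)
  show ?case
  proof (cases "a = b \<or> covers r a b")
    case True
    then show ?thesis using assms(2,3) by auto
  next
    case False
    then obtain c where c: "c \<noteq> a" "c \<noteq> b" "(a, c) \<in> r" "(c, b) \<in> r"
      using less.prems by (auto simp: covers_def)
    have "?I a c \<subset> ?I a b"
    proof
      show "?I a c \<subseteq> ?I a b" using c rel_trans by blast
      have "b \<in> ?I a b" "b \<notin> ?I a c"
        using c less.prems rel_refl rel_carrier rel_antisym by auto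
      then show "?I a c \<noteq> ?I a b" by blast
    qed
    moreover have "?I c b \<subset> ?I a b"
    proof
      show "?I c b \<subseteq> ?I a b" using c rel_trans by blast
      have "a \<in> ?I a b" "a \<notin> ?I c b"
        using c less.prems rel_refl rel_carrier rel_antisym by auto
      then show "?I c b \<noteq> ?I a b" by blast
    qed
    ultimately have "R a c" "R c b"
      using less.hyps c fin by (simp_all add: psubset_card_mono)
    then show ?thesis by (rule assms(4))
  qed
qed

text \<open>Induction over subsets of \<open>P\<close>: a maximal element is removed, the rest is
  labeled, and the removed element receives the new largest label.\<close>

lemma ex_natural_labeling: "\<exists>w. natural_labeling P r w"
proof -
  have "\<exists>w. bij_betw w Q {1..card Q} \<and> (\<forall>s\<in>Q. \<forall>t\<in>Q. (s, t) \<in> r \<and> s \<noteq> t \<longrightarrow> w s < w t)"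
    if "Q \<subseteq> P" for Q
    using that
  proof (induction "card Q" arbitrary: Q)
    case 0
    then have "Q = {}" using finite_subset[OF _ finite_carrier] by auto
    then show ?case by (auto simp: bij_betw_def)
  next
    case (Suc n)
    then have fin: "finite Q" and ne: "Q \<noteq> {}" using finite_subset[OF _ finite_carrier] by auto
    obtain p where p: "p \<in> Q" "\<And>q. q \<in> Q \<Longrightarrow> (p, q) \<in> r \<Longrightarrow> q = p"
      using finite_poset.ex_minimal[OF finite_poset_converse Suc.prems ne] by auto
    have n: "n = card (Q - {p})" using Suc fin p by simp
    then obtain w where w: "bij_betw w (Q - {p}) {1..n}"
      "\<forall>s\<in>Q - {p}. \<forall>t\<in>Q - {p}. (s, t) \<in> r \<and> s \<noteq> t \<longrightarrow> w s < w t"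
      using Suc.hyps(1)[OF n] Suc.prems by auto
    let ?w = "w(p := Suc n)"
    have "bij_betw ?w (Q - {p}) {1..n}"
      using w(1) by (rule bij_betw_cong[THEN iffD1, rotated]) simp
    then have "bij_betw ?w (insert p (Q - {p})) (insert (?w p) {1..n})"
      by (subst notIn_Un_bij_betw3[symmetric, simplified]) auto
    moreover have "insert p (Q - {p}) = Q" "insert (?w p) {1..n} = {1..card Q}"
      using p(1) Suc.hyps(2) by (auto simp: atLeastAtMostSuc_conv)
    ultimately have "bij_betw ?w Q {1..card Q}" by simp
    moreover have "?w s < ?w t" if "s \<in> Q" "t \<in> Q" "(s, t) \<in> r" "s \<noteq> t" for s t
    proof -
      have "s \<noteq> p" using that p(2) by blast
      then have "w s \<le> n" using w(1) that by (auto simp: bij_betw_def)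
      then show ?thesis using w(2) that \<open>s \<noteq> p\<close> by auto
    qed
    ultimately show ?case by blast
  qed
  from this[OF order_refl] show ?thesis
    unfolding natural_labeling_def labeling_def using rel_carrier by blast
qed

section \<open>Maximal chains and their splicing\<close>

lemma finite_Chains: "finite (Chains r)"
proof (rule finite_subset)
  show "Chains r \<subseteq> Pow P" using rel_carrier by (auto simp: Chains_def)
qed (simp add: finite_carrier)

lemma maximal_chain_subset: "maximal_chain r C \<Longrightarrow> C \<subseteq> P"
  using rel_carrier by (auto simp: maximal_chain_def Chains_def)

lemma ex_maximal_chain:
  assumes "C \<in> Chains r"
  shows "\<exists>D. maximal_chain r D \<and> C \<subseteq> D"
  using finite_has_maximal2[OF finite_Chains assms] by (auto simp: maximal_chain_def)

lemma maximal_chain_total: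
  "maximal_chain r C \<Longrightarrow> a \<in> C \<Longrightarrow> b \<in> C \<Longrightarrow> (a, b) \<in> r \<or> (b, a) \<in> r"
  by (auto simp: maximal_chain_def Chains_def)

lemma maximal_chain_memI:
  assumes "maximal_chain r C" "x \<in> P" "\<And>c. c \<in> C \<Longrightarrow> (x, c) \<in> r \<or> (c, x) \<in> r"
  shows "x \<in> C"
proof -
  have "insert x C \<in> Chains r"
    using assms rel_refl unfolding maximal_chain_def Chains_def by blast
  then have "insert x C = C"
    using assms(1) unfolding maximal_chain_def by blast
  then show ?thesis by blast
qed

text \<open>An element \<open>x\<close> that could extend the splice is comparable with
  \<open>p\<close>. If it lies below \<open>p\<close>, it is comparable with all of
  \<open>C\<close>: the lower half of \<open>C\<close> is in the splice, and the upper half lies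
  above \<open>p\<close>. Maximality of \<open>C\<close> then puts \<open>x\<close> into
  \<open>C\<close>; the case above \<open>p\<close> is the same with \<open>D\<close>.\<close>

lemma maximal_chain_splice:
  assumes C: "maximal_chain r C" "p \<in> C" and D: "maximal_chain r D" "p \<in> D"
  shows "maximal_chain r ({c \<in> C. (c, p) \<in> r} \<union> {d \<in> D. (p, d) \<in> r})"
proof -
  let ?E = "{c \<in> C. (c, p) \<in> r} \<union> {d \<in> D. (p, d) \<in> r}"
  have "?E \<in> Chains r"
    unfolding Chains_def
    using maximal_chain_total[OF C(1)] maximal_chain_total[OF D(1)] rel_trans by blast
  moreover have "F \<subseteq> ?E" if F: "F \<in> Chains r" "?E \<subseteq> F" for F
  proof
    fix x assume x: "x \<in> F"
    have tot: "\<And>y. y \<in> F \<Longrightarrow> (x, y) \<in> r \<or> (y, x) \<in> r" using F x by (auto simp: Chains_def)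
    have xP: "x \<in> P" using tot[OF x] rel_carrier by blast
    have p: "p \<in> F" using F C(2) maximal_chain_total[OF C(1) C(2) C(2)] by blast
    show "x \<in> ?E"
    proof (cases "(x, p) \<in> r")
      case True
      have "x \<in> C"
      proof (rule maximal_chain_memI[OF C(1) xP])
        fix c assume "c \<in> C"
        then show "(x, c) \<in> r \<or> (c, x) \<in> r"
          using maximal_chain_total[OF C(1) _ C(2), of c] F(2) tot True rel_trans by blast
      qed
      then show ?thesis using True by blast
    next
      case False
      then have px: "(p, x) \<in> r" using tot[OF p] by blast
      have "x \<in> D"
      proof (rule maximal_chain_memI[OF D(1) xP])
        fix d assume "d \<in> D"
        then show "(x, d) \<in> r \<or> (d, x) \<in> r"
          using maximal_chain_total[OF D(1) _ D(2), of d] F(2) tot px rel_trans by blast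
      qed
      then show ?thesis using px by blast
    qed
  qed
  ultimately show ?thesis unfolding maximal_chain_def by blast
qed

end

subsection \<open>Descent ranks\<close>

text \<open>When all maximal chains have \<open>k\<close> descents, \<open>\<delta> p\<close> is the number of descents below \<open>p\<close>
  on any maximal chain through \<open>p\<close>.\<close>

definition descent_rank :: "'a set \<Rightarrow> 'a rel \<Rightarrow> ('a \<Rightarrow> nat) \<Rightarrow> nat \<Rightarrow> ('a \<Rightarrow> nat) \<Rightarrow> bool" where
  "descent_rank P r w k \<delta> \<longleftrightarrow>
     (\<forall>a b. covers r a b \<longrightarrow> \<delta> b = \<delta> a + (if w b < w a then 1 else 0)) \<and>
     (\<forall>p\<in>P. (\<forall>q. (q, p) \<in> r \<longrightarrow> q = p) \<longrightarrow> \<delta> p = 0) \<and>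
     (\<forall>p\<in>P. (\<forall>q. (p, q) \<in> r \<longrightarrow> q = p) \<longrightarrow> \<delta> p = k)"

context finite_poset
begin

lemma finite_chain_descents: "finite (chain_descents r w C)"
  by (rule finite_subset[of _ "P \<times> P"])
     (use rel_carrier finite_carrier in \<open>auto simp: chain_descents_def covers_def\<close>)

text \<open>A descent is a cover relation, and \<open>p\<close>, being comparable with both of its
  ends, cannot lie strictly between them.\<close>

lemma card_chain_descents_split:
  assumes C: "maximal_chain r C" and p: "p \<in> C"
  shows "card (chain_descents r w C) =
    card {(a, b) \<in> chain_descents r w C. (b, p) \<in> r} +
    card {(a, b) \<in> chain_descents r w C. (p, a) \<in> r}"
proof -
  let ?L = "{(a, b) \<in> chain_descents r w C. (b, p) \<in> r}"
  let ?U = "{(a, b) \<in> chain_descents r w C. (p, a) \<in> r}"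
  have "(b, p) \<in> r \<or> (p, a) \<in> r" if "(a, b) \<in> chain_descents r w C" for a b
  proof (rule ccontr)
    assume n: "\<not> ((b, p) \<in> r \<or> (p, a) \<in> r)"
    have ab: "a \<in> C" "b \<in> C" "covers r a b" using that by (auto simp: chain_descents_def)
    have "(p, b) \<in> r" "(a, p) \<in> r"
      using n maximal_chain_total[OF C p ab(1)] maximal_chain_total[OF C p ab(2)] by auto
    moreover have "p \<noteq> a" "p \<noteq> b"
      using n maximal_chain_total[OF C p p] by auto
    ultimately show False using ab(3) by (auto simp: covers_def)
  qed
  then have "chain_descents r w C = ?L \<union> ?U" by auto
  then have "card (chain_descents r w C) = card (?L \<union> ?U)" by (rule arg_cong)
  moreover have "?L \<inter> ?U = {}"
  proof -
    have False if "(b, p) \<in> r" "(p, a) \<in> r" "covers r a b" for a b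
      using that rel_trans rel_antisym unfolding covers_def by metis
    then show ?thesis by (auto simp: chain_descents_def)
  qed
  moreover have "finite ?L" "finite ?U"
    using finite_chain_descents[of w C] by (auto intro: finite_subset[rotated])
  ultimately show ?thesis using card_Un_disjoint[of ?L ?U] by linarith
qed

text \<open>The splice \<open>E\<close> has the lower descents of \<open>C\<close> and the upper
  descents of \<open>D\<close>. Both \<open>E\<close> and \<open>D\<close> have \<open>k\<close>
  descents in total, so cancelling the common upper part leaves equal lower parts.\<close>

lemma card_descents_below_eq:
  assumes C: "maximal_chain r C" "p \<in> C" and D: "maximal_chain r D" "p \<in> D"
    and k: "\<And>C. maximal_chain r C \<Longrightarrow> card (chain_descents r w C) = k"
  shows "card {(a, b) \<in> chain_descents r w C. (b, p) \<in> r} =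
    card {(a, b) \<in> chain_descents r w D. (b, p) \<in> r}"
proof -
  define E where "E = {c \<in> C. (c, p) \<in> r} \<union> {d \<in> D. (p, d) \<in> r}"
  have E: "maximal_chain r E" unfolding E_def by (rule maximal_chain_splice[OF C D])
  have pp: "(p, p) \<in> r" using C maximal_chain_total by blast
  have pE: "p \<in> E" using C(2) pp by (simp add: E_def)
  \<comment> \<open>An element of the upper half that is also below \<open>p\<close> equals
    \<open>p\<close> by antisymmetry, and \<open>p\<close> lies in both chains.\<close>
  have lo: "x \<in> E \<longleftrightarrow> x \<in> C" if "(x, p) \<in> r" for x
    using that C(2) rel_antisym unfolding E_def by blast
  have up: "x \<in> E \<longleftrightarrow> x \<in> D" if "(p, x) \<in> r" for x
    using that D(2) rel_antisym unfolding E_def by blast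
  have "(a, b) \<in> chain_descents r w E \<longleftrightarrow> (a, b) \<in> chain_descents r w C" if "(b, p) \<in> r" for a b
  proof (cases "covers r a b")
    case True
    then have "(a, p) \<in> r" using that rel_trans unfolding covers_def by blast
    then show ?thesis using lo that by (simp add: chain_descents_def)
  qed (simp add: chain_descents_def)
  then have "{(a, b) \<in> chain_descents r w E. (b, p) \<in> r} =
      {(a, b) \<in> chain_descents r w C. (b, p) \<in> r}" by blast
  moreover have "(a, b) \<in> chain_descents r w E \<longleftrightarrow> (a, b) \<in> chain_descents r w D"
    if "(p, a) \<in> r" for a b
  proof (cases "covers r a b")
    case True
    then have "(p, b) \<in> r" using that rel_trans unfolding covers_def by blast
    then show ?thesis using up that by (simp add: chain_descents_def)
  qed (simp add: chain_descents_def)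
  then have "{(a, b) \<in> chain_descents r w E. (p, a) \<in> r} =
      {(a, b) \<in> chain_descents r w D. (p, a) \<in> r}" by blast
  ultimately show ?thesis
    using card_chain_descents_split[OF E pE, of w] card_chain_descents_split[OF D, of w]
      k[OF E] k[OF D(1)] by simp
qed

text \<open>The rank is read off an arbitrarily chosen maximal chain through \<open>p\<close>; by
  the exchange argument any other such chain gives the same number.\<close>

lemma ex_descent_rank:
  assumes k: "\<And>C. maximal_chain r C \<Longrightarrow> card (chain_descents r w C) = k"
  shows "\<exists>\<delta>. descent_rank P r w k \<delta>"
proof -
  define lower where "lower C p = {(a, b) \<in> chain_descents r w C. (b, p) \<in> r}" for C p
  define \<delta> where "\<delta> p = card (lower (SOME C. maximal_chain r C \<and> p \<in> C) p)" for p
  have \<delta>: "\<delta> p = card (lower C p)" if C: "maximal_chain r C" "p \<in> C" for C p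
  proof -
    have "maximal_chain r (SOME C. maximal_chain r C \<and> p \<in> C) \<and>
        p \<in> (SOME C. maximal_chain r C \<and> p \<in> C)"
      using C by (intro someI[of "\<lambda>C. maximal_chain r C \<and> p \<in> C" C]) simp
    then show ?thesis
      unfolding \<delta>_def lower_def using C k by (intro card_descents_below_eq) auto
  qed
  have ex: "\<exists>C. maximal_chain r C \<and> p \<in> C" if "p \<in> P" for p
    using ex_maximal_chain[of "{p}"] rel_refl[OF that] by (auto simp: Chains_def)
  have "\<delta> b = \<delta> a + (if w b < w a then 1 else 0)" if ab: "covers r a b" for a b
  proof -
    have r: "(a, b) \<in> r" "a \<noteq> b" and between: "\<And>c. (a, c) \<in> r \<Longrightarrow> (c, b) \<in> r \<Longrightarrow> c = a \<or> c = b"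
      using ab by (auto simp: covers_def)
    \<comment> \<open>A single maximal chain through both \<open>a\<close> and \<open>b\<close>
      serves to compute both ranks.\<close>
    have "{a, b} \<in> Chains r" using r rel_refl rel_carrier by (auto simp: Chains_def)
    then obtain C where C: "maximal_chain r C" "a \<in> C" "b \<in> C" using ex_maximal_chain by blast
    have "lower C b = lower C a \<union> (if w b < w a then {(a, b)} else {})"
    proof (intro equalityI subsetI)
      fix x assume "x \<in> lower C b"
      then obtain c d where x: "x = (c, d)" "c \<in> C" "d \<in> C" "covers r c d" "w d < w c" "(d, b) \<in> r"
        by (auto simp: lower_def chain_descents_def)
      show "x \<in> lower C a \<union> (if w b < w a then {(a, b)} else {})"
      proof (cases "(d, a) \<in> r")
        case True
        then show ?thesis using x by (auto simp: lower_def chain_descents_def)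
      next
        case False
        \<comment> \<open>A descent below \<open>b\<close> but not below \<open>a\<close> must end
          in \<open>b\<close>, and its lower end is \<open>a\<close> because a chain has only one
          element covered by \<open>b\<close>.\<close>
        then have "(a, d) \<in> r" "d \<noteq> a"
          using maximal_chain_total[OF C(1,2) x(3)] by auto
        then have d: "d = b" using between x(6) by blast
        have cd: "(c, d) \<in> r" "c \<noteq> d" "\<And>e. (c, e) \<in> r \<Longrightarrow> (e, d) \<in> r \<Longrightarrow> e = c \<or> e = d"
          using x(4) by (auto simp: covers_def)
        have "c = a"
          using maximal_chain_total[OF C(1) x(2) C(2)]
        proof
          assume "(c, a) \<in> r" then show ?thesis using cd(3)[of a] r d by auto
        next
          assume "(a, c) \<in> r" then show ?thesis using between cd d by blast
        qed
        then show ?thesis using x d by auto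
      qed
    next
      fix x assume "x \<in> lower C a \<union> (if w b < w a then {(a, b)} else {})"
      then consider "x \<in> lower C a" | "x = (a, b)" "w b < w a" by (auto split: if_splits)
      then show "x \<in> lower C b"
      proof cases
        case 1
        then show ?thesis using r(1) rel_trans unfolding lower_def by blast
      next
        case 2
        then show ?thesis
          using r(1) C ab rel_refl rel_carrier by (simp add: lower_def chain_descents_def)
      qed
    qed
    moreover have "(a, b) \<notin> lower C a"
      using r rel_antisym by (auto simp: lower_def)
    moreover have "finite (lower C a)"
      unfolding lower_def using finite_chain_descents[of w C] by (auto intro: finite_subset[rotated])
    ultimately show ?thesis using \<delta>[OF C(1,2)] \<delta>[OF C(1,3)] by simp
  qed
  moreover have "\<delta> p = 0" if "p \<in> P" "\<forall>q. (q, p) \<in> r \<longrightarrow> q = p" for p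
  proof -
    obtain C where C: "maximal_chain r C" "p \<in> C" using ex \<open>p \<in> P\<close> by blast
    have "\<not> covers r a b" if "(b, p) \<in> r" for a b
      using that \<open>\<forall>q. (q, p) \<in> r \<longrightarrow> q = p\<close> unfolding covers_def by blast
    then have "lower C p = {}" by (auto simp: lower_def chain_descents_def)
    then show ?thesis using \<delta>[OF C] by simp
  qed
  moreover have "\<delta> p = k" if "p \<in> P" "\<forall>q. (p, q) \<in> r \<longrightarrow> q = p" for p
  proof -
    obtain C where C: "maximal_chain r C" "p \<in> C" using ex \<open>p \<in> P\<close> by blast
    \<comment> \<open>A maximal element is the top of every chain through it, so all
      \<open>k\<close> descents are counted.\<close>
    have "(q, p) \<in> r" if "q \<in> C" for q
      using maximal_chain_total[OF C that] \<open>\<forall>q. (p, q) \<in> r \<longrightarrow> q = p\<close> \<open>p \<in> P\<close> rel_refl by blast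
    then have "lower C p = chain_descents r w C"
      by (auto simp: lower_def chain_descents_def)
    then show ?thesis using \<delta>[OF C] k[OF C(1)] by simp
  qed
  ultimately show ?thesis unfolding descent_rank_def by blast
qed

text \<open>Along each cover, hence along each relation, \<open>\<tau>\<close> grows at least as
  much as \<open>\<delta>\<close>; so \<open>\<tau> - \<delta>\<close> is order preserving. Since
  every element lies above one of rank 0 and below one of rank \<open>k\<close>, the difference
  ranges between 0 and \<open>j - k\<close>. Adding \<open>\<delta>\<close> is the inverse.\<close>

lemma Omega_descent_rank:
  assumes ne: "P \<noteq> {}" and \<delta>: "descent_rank P r v k \<delta>"
  shows "Omega P r v j =
    (if j < k then 0 else card {\<tau> \<in> P \<rightarrow>\<^sub>E {0..j - k}. \<forall>s t. (s, t) \<in> r \<longrightarrow> \<tau> s \<le> \<tau> t})"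
proof -
  define S where "S = {\<tau> \<in> P \<rightarrow>\<^sub>E {0..j}. (\<forall>s t. (s, t) \<in> r \<longrightarrow> \<tau> s \<le> \<tau> t) \<and>
      (\<forall>s t. (s, t) \<in> r \<and> s \<noteq> t \<and> v s > v t \<longrightarrow> \<tau> s < \<tau> t)}"
  define T where "T = {\<tau> \<in> P \<rightarrow>\<^sub>E {0..j - k}. \<forall>s t. (s, t) \<in> r \<longrightarrow> \<tau> s \<le> \<tau> t}"
  have Omega: "Omega P r v j = card S" by (simp add: Omega_def S_def)
  have cov: "\<And>a b. covers r a b \<Longrightarrow> \<delta> b = \<delta> a + (if v b < v a then 1 else 0)"
    using \<delta> by (simp add: descent_rank_def)
  \<comment> \<open>If the rank stays constant along a saturated chain, none of its covers is a
    descent, so the labels do not decrease.\<close>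
  have mono: "\<delta> a \<le> \<delta> b \<and> (\<delta> a = \<delta> b \<longrightarrow> v a \<le> v b)" if "(a, b) \<in> r" for a b
    using that by (rule cover_induct) (auto simp: cov)
  have below: "\<exists>q. (q, p) \<in> r \<and> \<delta> q = 0" if "p \<in> P" for p
    using ex_minimal_below[OF that] \<delta> rel_carrier unfolding descent_rank_def by blast
  have above: "\<exists>q. (p, q) \<in> r \<and> \<delta> q = k" if "p \<in> P" for p
    using finite_poset.ex_minimal_below[OF finite_poset_converse that] \<delta> rel_carrier
    unfolding descent_rank_def by (metis converse_iff)
  have le_k: "\<delta> p \<le> k" if "p \<in> P" for p using above[OF that] mono by blast
  have gap: "\<tau> a + \<delta> b \<le> \<tau> b + \<delta> a" if \<tau>: "\<tau> \<in> S" and "(a, b) \<in> r" for \<tau> a b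
  proof (rule cover_induct[OF that(2)])
    fix a b assume ab: "covers r a b"
    then have "(a, b) \<in> r" "a \<noteq> b" by (simp_all add: covers_def)
    then have "\<tau> a \<le> \<tau> b" "v a > v b \<longrightarrow> \<tau> a < \<tau> b" using \<tau> by (auto simp: S_def)
    then show "\<tau> a + \<delta> b \<le> \<tau> b + \<delta> a" using cov[OF ab] by (auto split: if_splits)
  qed simp_all
  have lower: "\<delta> p \<le> \<tau> p" if "\<tau> \<in> S" "p \<in> P" for \<tau> p
    using below[OF that(2)] gap[OF that(1)] by fastforce
  have upper: "\<tau> p + k \<le> j + \<delta> p" if "\<tau> \<in> S" "p \<in> P" for \<tau> p
  proof -
    obtain q where q: "(p, q) \<in> r" "\<delta> q = k" using above[OF \<open>p \<in> P\<close>] by blast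
    then have "\<tau> q \<le> j" using that(1) rel_carrier by (auto simp: S_def PiE_iff)
    then show ?thesis using gap[OF that(1) q(1)] q(2) by simp
  qed
  show ?thesis
  proof (cases "j < k")
    case True
    \<comment> \<open>Some element has rank \<open>k\<close>, and its value would have to be at
      least \<open>k > j\<close>.\<close>
    obtain p where "p \<in> P" using ne by blast
    then obtain q where q: "q \<in> P" "\<delta> q = k" using above rel_carrier by blast
    have "\<tau> \<notin> S" for \<tau>
    proof
      assume "\<tau> \<in> S"
      then have "\<tau> q \<le> j" "k \<le> \<tau> q" using lower[of \<tau> q] q by (auto simp: S_def PiE_iff)
      then show False using True by simp
    qed
    then have "S = {}" by blast
    then show ?thesis using True by (simp add: Omega)
  next
    case False
    \<comment> \<open>By \<open>lower\<close>, the subtraction of natural numbers never truncates on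
      \<open>S\<close>.\<close>
    have "bij_betw (\<lambda>\<tau>. restrict (\<lambda>p. \<tau> p - \<delta> p) P) S T"
    proof (rule bij_betw_byWitness[where f' = "\<lambda>\<tau>. restrict (\<lambda>p. \<tau> p + \<delta> p) P"])
      show "\<forall>\<tau>\<in>S. restrict (\<lambda>p. restrict (\<lambda>p. \<tau> p - \<delta> p) P p + \<delta> p) P = \<tau>"
        using lower by (auto simp: S_def PiE_iff extensional_def fun_eq_iff)
      show "\<forall>\<tau>\<in>T. restrict (\<lambda>p. restrict (\<lambda>p. \<tau> p + \<delta> p) P p - \<delta> p) P = \<tau>"
        by (auto simp: T_def PiE_iff extensional_def fun_eq_iff)
      show "(\<lambda>\<tau>. restrict (\<lambda>p. \<tau> p - \<delta> p) P) ` S \<subseteq> T"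
      proof (rule image_subsetI)
        fix \<tau> assume \<tau>: "\<tau> \<in> S"
        let ?\<rho> = "restrict (\<lambda>p. \<tau> p - \<delta> p) P"
        have "?\<rho> p \<le> j - k" if "p \<in> P" for p
          using upper[OF \<tau> that] that by simp
        moreover have "?\<rho> s \<le> ?\<rho> t" if st: "(s, t) \<in> r" for s t
          using gap[OF \<tau> st] lower[OF \<tau>, of t] rel_carrier[OF st] by simp
        ultimately show "?\<rho> \<in> T" by (simp add: T_def PiE_iff)
      qed
      show "(\<lambda>\<tau>. restrict (\<lambda>p. \<tau> p + \<delta> p) P) ` T \<subseteq> S"
      proof (rule image_subsetI)
        fix \<tau> assume \<tau>: "\<tau> \<in> T"
        let ?\<rho> = "restrict (\<lambda>p. \<tau> p + \<delta> p) P"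
        have "?\<rho> p \<le> j" if "p \<in> P" for p
        proof -
          have "\<tau> p \<le> j - k" using \<tau> that by (auto simp: T_def PiE_iff)
          then show ?thesis using le_k[OF that] False that by simp
        qed
        \<comment> \<open>If \<open>v s > v t\<close>, then \<open>mono\<close> forces
          \<open>\<delta> s < \<delta> t\<close>, which makes the sum strictly increasing.\<close>
        moreover have "?\<rho> s \<le> ?\<rho> t \<and> (v s > v t \<longrightarrow> ?\<rho> s < ?\<rho> t)" if st: "(s, t) \<in> r" for s t
        proof -
          have "\<tau> s \<le> \<tau> t" using \<tau> st by (simp add: T_def)
          then show ?thesis using mono[OF st] rel_carrier[OF st] by auto
        qed
        ultimately show "?\<rho> \<in> S" by (simp add: S_def PiE_iff)
      qed
    qed
    then have "card S = card T" by (rule bij_betw_same_card)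
    then show ?thesis using False by (simp add: Omega T_def)
  qed
qed

text \<open>Replacing \<open>j\<close> by \<open>j - k\<close> in the counts, with zeros for
  \<open>j < k\<close>, multiplies their generating series by \<open>fps_X ^ k\<close>.\<close>

lemma hstar_descent_rank:
  assumes ne: "P \<noteq> {}" and \<delta>: "descent_rank P r v k \<delta>"
  shows "hstar P r v = monom 1 k * hstar_natural P r"
proof -
  obtain w where w: "natural_labeling P r w" using ex_natural_labeling by blast
  then have inj: "inj_on w P" by (auto simp: natural_labeling_def labeling_def bij_betw_def)
  have "Abs_fps (\<lambda>j. int (Omega P r v j)) = fps_X ^ k * Abs_fps (\<lambda>j. int (Omega P r w j))"
    by (rule fps_ext)
       (simp add: Omega_descent_rank[OF ne \<delta>] Omega_natural[OF w] fps_X_power_mult_nth)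
  then have "Abs_fps (\<lambda>j. int (Omega P r v j)) * (1 - fps_X) ^ (card P + 1) =
      fps_of_poly (monom 1 k * hstar P r w)"
    using hstar_gf(1)[OF finite_carrier rel_subset inj]
    by (simp add: fps_of_poly_mult fps_of_poly_monom' mult.assoc)
  then show ?thesis
    by (simp add: hstar_eqI hstar_natural_eq[OF w])
qed

text \<open>Each element except the least one \<open>m\<close> is the upper end of exactly one cover
  inside the chain. Maximality matters: neighbours in the chain are covers in the whole
  poset.\<close>

lemma card_covers_maximal_chain:
  assumes C: "maximal_chain r C" and ne: "C \<noteq> {}"
  shows "card {(a, b). a \<in> C \<and> b \<in> C \<and> covers r a b} = card C - 1"
proof -
  let ?S = "{(a, b). a \<in> C \<and> b \<in> C \<and> covers r a b}"
  note tot = maximal_chain_total[OF C]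
  note sub = maximal_chain_subset[OF C]
  obtain m where m: "m \<in> C" "\<And>q. q \<in> C \<Longrightarrow> (q, m) \<in> r \<Longrightarrow> q = m"
    using ex_minimal[OF sub ne] by blast
  have "inj_on snd ?S"
  proof (rule inj_onI, clarsimp)
    fix a c b assume "a \<in> C" "c \<in> C" "covers r a b" "covers r c b"
    then show "a = c" using tot[of a c] by (auto simp: covers_def)
  qed
  moreover have "snd ` ?S = C - {m}"
  proof (intro equalityI subsetI)
    fix b assume "b \<in> snd ` ?S"
    then show "b \<in> C - {m}" using m(2) by (auto simp: covers_def)
  next
    fix b assume b: "b \<in> C - {m}"
    let ?A = "{c \<in> C. (c, b) \<in> r \<and> c \<noteq> b}"
    have "m \<in> ?A" using b m tot[of m b] by auto
    then have A: "?A \<subseteq> P" "?A \<noteq> {}" using sub by blast+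
    \<comment> \<open>The predecessor of \<open>b\<close> is a maximal element among the chain
      elements strictly below \<open>b\<close>.\<close>
    obtain a where a: "a \<in> C" "(a, b) \<in> r" "a \<noteq> b"
      and top: "\<And>c. c \<in> C \<Longrightarrow> (c, b) \<in> r \<Longrightarrow> c \<noteq> b \<Longrightarrow> (a, c) \<in> r \<Longrightarrow> c = a"
      using finite_poset.ex_minimal[OF finite_poset_converse A] by auto
    have False if c: "c \<noteq> a" "c \<noteq> b" "(a, c) \<in> r" "(c, b) \<in> r" for c
    proof -
      \<comment> \<open>An element between \<open>a\<close> and \<open>b\<close> is comparable with
        the whole chain, so it belongs to the chain and contradicts the choice of
        \<open>a\<close>.\<close>
      have "c \<in> C"
      proof (rule maximal_chain_memI[OF C])
        show "c \<in> P" using c rel_carrier by blast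
        fix d assume d: "d \<in> C"
        show "(c, d) \<in> r \<or> (d, c) \<in> r"
        proof (cases "(b, d) \<in> r")
          case True
          then show ?thesis using c rel_trans by blast
        next
          case False
          then have "(d, b) \<in> r" "d \<noteq> b" using tot[of b d] b d rel_refl sub by auto
          then have "(d, a) \<in> r" using tot[of a d] a d top by blast
          then show ?thesis using c rel_trans by blast
        qed
      qed
      then show False using top c by blast
    qed
    then have "covers r a b" using a by (auto simp: covers_def)
    then show "b \<in> snd ` ?S" using a b by force
  qed
  ultimately have "card ?S = card (C - {m})" using card_image[of snd ?S] by simp
  then show ?thesis using m(1) by simp
qed

end

subsection \<open>The product with a chain\<close>

lemma des_map_upt:
  "des (map \<sigma> [1..<n + 1]) = card {t \<in> {1..<n}. \<sigma> (Suc t) < \<sigma> t}"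
proof -
  let ?D = "{i. Suc i < n \<and> \<sigma> (Suc (Suc i)) < \<sigma> (Suc i)}"
  have "des (map \<sigma> [1..<n + 1]) = card ?D"
    unfolding des_def by (rule arg_cong[where f = card]) (auto simp del: upt_Suc)
  \<comment> \<open>List positions start at 0, arguments of \<open>\<sigma>\<close> at 1.\<close>
  moreover have "{t \<in> {1..<n}. \<sigma> (Suc t) < \<sigma> t} = Suc ` ?D"
  proof (intro equalityI subsetI)
    fix t assume "t \<in> {t \<in> {1..<n}. \<sigma> (Suc t) < \<sigma> t}"
    then show "t \<in> Suc ` ?D" by (intro image_eqI[of _ _ "t - 1"]) auto
  qed auto
  ultimately show ?thesis by (simp add: card_image)
qed

text \<open>The coordinates cannot both change, as \<open>(p, j)\<close> would lie strictly between,
  and a longer step in the chain passes through \<open>(p, Suc i)\<close>.\<close>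

lemma covers_prod_chain_rel:
  assumes "covers (prod_chain_rel r n) (p, i) (q, j)" "refl_on P r" "r \<subseteq> P \<times> P"
  shows "p = q \<and> j = Suc i \<or> covers r p q \<and> i = j"
proof -
  have "((p, i), (q, j)) \<in> prod_chain_rel r n" "(p, i) \<noteq> (q, j)"
    using assms(1) unfolding covers_def by blast+
  then have pq: "(p, q) \<in> r" "i \<in> {1..n}" "j \<in> {1..n}" "i \<le> j" "p = q \<longrightarrow> i \<noteq> j"
    by (auto simp: prod_chain_rel_def)
  have nb: "y = (p, i) \<or> y = (q, j)"
    if "((p, i), y) \<in> prod_chain_rel r n" "(y, (q, j)) \<in> prod_chain_rel r n" for y
    using assms(1) that unfolding covers_def by blast
  have rf: "(p, p) \<in> r" "(q, q) \<in> r" using assms(2,3) pq(1) by (auto simp: refl_on_def)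
  show ?thesis
  proof (cases "p = q")
    case True
    then have "j = Suc i"
      using nb[of "(p, Suc i)"] pq rf by (auto simp: prod_chain_rel_def)
    then show ?thesis using True by simp
  next
    case False
    have "i = j" using nb[of "(p, j)"] pq rf False by (auto simp: prod_chain_rel_def)
    moreover have "c = p \<or> c = q" if "(p, c) \<in> r" "(c, q) \<in> r" for c
      using nb[of "(c, i)"] that pq \<open>i = j\<close> by (auto simp: prod_chain_rel_def)
    ultimately show ?thesis using False pq unfolding covers_def by blast
  qed
qed

lemma inj_on_prod_labeling:
  assumes "labeling P w" "\<sigma> permutes {1..n}"
  shows "inj_on (prod_labeling P w \<sigma>) (P \<times> {1..n})"
proof (rule inj_onI, clarify)
  fix p i q j
  assume mem: "p \<in> P" "q \<in> P" "i \<in> {1..n}" "j \<in> {1..n}"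
    and eq: "prod_labeling P w \<sigma> (p, i) = prod_labeling P w \<sigma> (q, j)"
  have \<sigma>: "1 \<le> \<sigma> i" "1 \<le> \<sigma> j" using permutes_in_image[OF assms(2)] mem by fastforce+
  have w: "w p \<in> {1..card P}" "w q \<in> {1..card P}"
    using assms(1) mem by (auto simp: labeling_def bij_betw_def)
  \<comment> \<open>Shifted to start at 0, a label is a number below \<open>card P\<close> plus a
    multiple of \<open>card P\<close>; quotient and remainder recover \<open>\<sigma> i\<close> and
    \<open>w p\<close>.\<close>
  have e: "(w p - 1) + (\<sigma> i - 1) * card P = (w q - 1) + (\<sigma> j - 1) * card P"
    using eq w by (auto simp: prod_labeling_def)
  have lt: "w p - 1 < card P" "w q - 1 < card P" using w by auto
  have "\<sigma> i - 1 = \<sigma> j - 1" using arg_cong[OF e, of "\<lambda>x. x div card P"] lt by simp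
  then have "\<sigma> i = \<sigma> j" using \<sigma> by simp
  moreover have "w p - 1 = w q - 1" using arg_cong[OF e, of "\<lambda>x. x mod card P"] lt by simp
  then have "w p = w q" using w by auto
  ultimately show "p = q \<and> i = j"
    using permutes_inj[OF assms(2)] assms(1) mem
    by (auto simp: labeling_def bij_betw_def inj_on_def inj_def)
qed

context finite_poset
begin

lemma finite_poset_prod: "finite_poset (P \<times> {1..n}) (prod_chain_rel r n)"
proof
  show "finite (P \<times> {1..n})" using finite_carrier by simp
  have "antisym (prod_chain_rel r n)"
    using rel_antisym by (auto simp: antisym_def prod_chain_rel_def)
  moreover have "trans (prod_chain_rel r n)"
    using rel_trans by (auto simp: trans_def prod_chain_rel_def)
  moreover have "refl_on (P \<times> {1..n}) (prod_chain_rel r n)"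
    using rel_refl by (auto simp: refl_on_def prod_chain_rel_def)
  moreover have "prod_chain_rel r n \<subseteq> (P \<times> {1..n}) \<times> (P \<times> {1..n})"
    using rel_carrier by (auto simp: prod_chain_rel_def)
  ultimately show "partial_order_on (P \<times> {1..n}) (prod_chain_rel r n)"
    by (simp add: partial_order_on_def preorder_on_def)
qed

text \<open>A cover moves in one coordinate. Within \<open>P\<close> the multiple of
  \<open>card P\<close> is fixed and \<open>w\<close> decides; within the chain \<open>w p\<close>
  is fixed and \<open>\<sigma>\<close> decides. So the two ranks add, and they reach their extreme
  values at \<open>i = 1\<close> and \<open>i = n\<close>.\<close>

lemma descent_rank_prod:
  assumes \<delta>: "descent_rank P r w k \<delta>" and \<sigma>: "\<sigma> permutes {1..n}"
  shows "descent_rank (P \<times> {1..n}) (prod_chain_rel r n) (prod_labeling P w \<sigma>)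
    (k + des (map \<sigma> [1..<n + 1])) (\<lambda>(p, i). \<delta> p + card {t \<in> {1..<i}. \<sigma> (Suc t) < \<sigma> t})"
  unfolding descent_rank_def des_map_upt
proof (intro conjI ballI allI impI)
  let ?d = "\<lambda>i. card {t \<in> {1..<i}. \<sigma> (Suc t) < \<sigma> t}"
  fix a b assume ab: "covers (prod_chain_rel r n) a b"
  obtain p i q j where a: "a = (p, i)" and b: "b = (q, j)" by (cases a, cases b)
  have mem: "p \<in> P" "q \<in> P" "i \<in> {1..n}" "j \<in> {1..n}"
    using ab rel_carrier unfolding covers_def a b by (auto simp: prod_chain_rel_def)
  \<comment> \<open>Multiples of a positive \<open>card P\<close> are ordered like their
    factors.\<close>
  have m: "card P > 0" using mem finite_carrier by (auto simp: card_gt_0_iff)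
  have \<sigma>1: "1 \<le> \<sigma> i" "1 \<le> \<sigma> j" using permutes_in_image[OF \<sigma>] mem by fastforce+
  have "p = q \<and> j = Suc i \<or> covers r p q \<and> i = j"
    using covers_prod_chain_rel[OF ab[unfolded a b]] partial_order_onD(1)[OF order] rel_subset by blast
  then show "(case b of (p, i) \<Rightarrow> \<delta> p + ?d i) = (case a of (p, i) \<Rightarrow> \<delta> p + ?d i) +
      (if prod_labeling P w \<sigma> b < prod_labeling P w \<sigma> a then 1 else 0)"
  proof
    assume j: "p = q \<and> j = Suc i"
    have "{t \<in> {1..<Suc i}. \<sigma> (Suc t) < \<sigma> t} =
        {t \<in> {1..<i}. \<sigma> (Suc t) < \<sigma> t} \<union> (if \<sigma> (Suc i) < \<sigma> i then {i} else {})"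
      using mem(3) by (auto simp: less_Suc_eq)
    then have "?d (Suc i) = ?d i + (if \<sigma> (Suc i) < \<sigma> i then 1 else 0)" by simp
    moreover have "prod_labeling P w \<sigma> b < prod_labeling P w \<sigma> a \<longleftrightarrow> \<sigma> (Suc i) < \<sigma> i"
      using j m \<sigma>1 by (auto simp: prod_labeling_def a b)
    ultimately show ?thesis using j by (simp add: a b)
  next
    assume "covers r p q \<and> i = j"
    then show ?thesis using \<delta> by (auto simp: descent_rank_def prod_labeling_def a b)
  qed
next
  fix x assume x: "x \<in> P \<times> {1..n}" and min: "\<forall>y. (y, x) \<in> prod_chain_rel r n \<longrightarrow> y = x"
  obtain p i where pi: "x = (p, i)" "p \<in> P" "i \<in> {1..n}" using x by blast
  have "i = 1" using min[rule_format, of "(p, 1)"] pi rel_refl by (auto simp: prod_chain_rel_def)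
  moreover have "\<forall>q. (q, p) \<in> r \<longrightarrow> q = p"
    using min pi by (auto simp: prod_chain_rel_def)
  then have "\<delta> p = 0" using \<delta> pi by (simp add: descent_rank_def)
  ultimately show "(case x of (p, i) \<Rightarrow> \<delta> p + card {t \<in> {1..<i}. \<sigma> (Suc t) < \<sigma> t}) = 0"
    by (simp add: pi)
next
  fix x assume x: "x \<in> P \<times> {1..n}" and max: "\<forall>y. (x, y) \<in> prod_chain_rel r n \<longrightarrow> y = x"
  obtain p i where pi: "x = (p, i)" "p \<in> P" "i \<in> {1..n}" using x by blast
  have "i = n" using max[rule_format, of "(p, n)"] pi rel_refl by (auto simp: prod_chain_rel_def)
  moreover have "\<forall>q. (p, q) \<in> r \<longrightarrow> q = p"
    using max pi by (auto simp: prod_chain_rel_def)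
  then have "\<delta> p = k" using \<delta> pi by (simp add: descent_rank_def)
  ultimately show "(case x of (p, i) \<Rightarrow> \<delta> p + card {t \<in> {1..<i}. \<sigma> (Suc t) < \<sigma> t}) =
      k + card {t \<in> {1..<n}. \<sigma> (Suc t) < \<sigma> t}"
    by (simp add: pi)
qed

lemma C_poly_eq:
  assumes "P \<noteq> {}" "labeling P w" "n \<ge> 1"
    and "\<And>C. maximal_chain r C \<Longrightarrow> card (chain_descents r w C) = k"
  shows "C_poly P r w n =
    monom 1 k * A_poly n * hstar_natural (P \<times> {1..n}) (prod_chain_rel r n)"
proof -
  interpret prod: finite_poset "P \<times> {1..n}" "prod_chain_rel r n" by (rule finite_poset_prod)
  obtain \<delta> where \<delta>: "descent_rank P r w k \<delta>" using ex_descent_rank assms(4) by blast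
  let ?H = "hstar_natural (P \<times> {1..n}) (prod_chain_rel r n)"
  have "(\<Sum>\<pi>\<in>linext_words (P \<times> {1..n}) (prod_chain_rel r n) (prod_labeling P w \<sigma>). monom 1 (des \<pi>)) =
      monom 1 k * monom 1 (des (map \<sigma> [1..<n + 1])) * ?H" if \<sigma>: "\<sigma> permutes {1..n}" for \<sigma>
  proof -
    have "P \<times> {1..n} \<noteq> {}" using assms(1,3) by auto
    then show ?thesis
      using hstar_gf(2)[OF prod.finite_carrier prod.rel_subset inj_on_prod_labeling[OF assms(2) \<sigma>]]
        prod.hstar_descent_rank[OF _ descent_rank_prod[OF \<delta> \<sigma>]]
      by (simp add: mult_monom)
  qed
  then show ?thesis
    unfolding C_poly_def A_poly_def by (simp add: sum_distrib_left sum_distrib_right)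
qed

end

subsection \<open>Complementary labelings\<close>

text \<open>Distinctness excludes ties, so each of the \<open>length xs - 1\<close> adjacent
  positions is a descent for exactly one of \<open>f\<close> and \<open>g\<close>.\<close>

lemma des_map_antimono:
  assumes "distinct (map f xs)"
    and "\<And>x y. x \<in> set xs \<Longrightarrow> y \<in> set xs \<Longrightarrow> g x < g y \<longleftrightarrow> f y < f x"
  shows "des (map g xs) = length xs - 1 - des (map f xs)"
proof -
  let ?D = "\<lambda>h. {i. Suc i < length xs \<and> h (xs ! Suc i) < (h (xs ! i) :: nat)}"
  have "?D g = {..<length xs - 1} - ?D f"
  proof (intro equalityI subsetI)
    fix i assume i: "i \<in> {..<length xs - 1} - ?D f"
    then have "Suc i < length xs" by auto
    moreover from this have "f (xs ! Suc i) \<noteq> f (xs ! i)"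
      using assms(1) nth_eq_iff_index_eq[of "map f xs" "Suc i" i] by simp
    ultimately show "i \<in> ?D g" using assms(2)[of "xs ! Suc i" "xs ! i"] i by auto
  next
    fix i assume i: "i \<in> ?D g"
    then show "i \<in> {..<length xs - 1} - ?D f"
      using assms(2)[of "xs ! Suc i" "xs ! i"] by auto
  qed
  moreover have "?D f \<subseteq> {..<length xs - 1}" by auto
  ultimately have "card (?D g) = length xs - 1 - card (?D f)"
    by (simp add: card_Diff_subset finite_subset)
  then show ?thesis by (simp add: des_def conj_commute cong: conj_cong)
qed

lemma des_le: "des xs \<le> length xs - 1"
proof -
  have "{i. Suc i < length xs \<and> xs ! Suc i < xs ! i} \<subseteq> {..<length xs - 1}" by auto
  from card_mono[OF _ this] show ?thesis by (simp add: des_def)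
qed

lemma labeling_complement:
  assumes "labeling P w"
  shows "labeling P (\<lambda>p. card P + 1 - w p)"
proof -
  have "bij_betw (\<lambda>x. card P + 1 - x) {1..card P} {1..card P}"
    by (rule bij_betw_byWitness[where f' = "\<lambda>x. card P + 1 - x"]) auto
  then show ?thesis
    using assms bij_betw_trans unfolding labeling_def comp_def by fastforce
qed

lemma permutes_reversal:
  fixes n :: nat
  shows "(\<lambda>i. if i \<in> {1..n} then n + 1 - i else i) permutes {1..n}" (is "?\<rho> permutes _")
proof (rule bij_imp_permutes)
  show "bij_betw ?\<rho> {1..n} {1..n}"
    by (rule bij_betw_byWitness[where f' = ?\<rho>]) auto
qed auto

text \<open>Complementing a product label reverses the order of the blocks, through the reversal
  composed with \<open>\<sigma>\<close>, and the order inside each block, through the complement of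
  \<open>w\<close>. A constant sum shows at once that comparisons are reversed.\<close>

lemma prod_labeling_complement:
  assumes "labeling P w" "\<sigma> permutes {1..n}" "p \<in> P" "i \<in> {1..n}"
  shows "prod_labeling P (\<lambda>p. card P + 1 - w p)
      ((\<lambda>i. if i \<in> {1..n} then n + 1 - i else i) \<circ> \<sigma>) (p, i) + prod_labeling P w \<sigma> (p, i) =
    card P * n + 1"
proof -
  have w: "w p \<in> {1..card P}" using assms(1,3) by (auto simp: labeling_def bij_betw_def)
  have \<sigma>: "\<sigma> i \<in> {1..n}" using permutes_in_image[OF assms(2)] assms(4) by blast
  \<comment> \<open>The \<open>n\<close> blocks are those after block \<open>\<sigma> i\<close>,
    those before it, and the block itself.\<close>
  have "n = (n - \<sigma> i) + (\<sigma> i - 1) + 1" using \<sigma> by auto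
  then have "card P * n = (n - \<sigma> i) * card P + (\<sigma> i - 1) * card P + card P"
    by (metis add_mult_distrib mult.commute mult_1)
  then show ?thesis using w \<sigma> by (auto simp: prod_labeling_def)
qed

text \<open>Summing over the extensions instead of their words makes the inner index set independent
  of the labeling, so labelings can be compared term by term.\<close>

lemma C_poly_alt:
  assumes "labeling P w"
  shows "C_poly P r w n = (\<Sum>\<sigma> | \<sigma> permutes {1..n}.
    \<Sum>ps\<in>linear_extensions (P \<times> {1..n}) (prod_chain_rel r n).
      monom 1 (des (map (prod_labeling P w \<sigma>) ps)))"
  unfolding C_poly_def linext_words_def
proof (intro sum.cong refl)
  fix \<sigma> assume "\<sigma> \<in> {\<sigma>. \<sigma> permutes {1..n}}"
  then have "inj_on (prod_labeling P w \<sigma>) (P \<times> {1..n})"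
    using inj_on_prod_labeling[OF assms] by blast
  then have "inj_on (map (prod_labeling P w \<sigma>)) (linear_extensions (P \<times> {1..n}) (prod_chain_rel r n))"
    by (intro inj_on_mapI) (auto simp: linear_extensions_iff)
  then show "(\<Sum>\<pi>\<in>map (prod_labeling P w \<sigma>) ` linear_extensions (P \<times> {1..n}) (prod_chain_rel r n).
      monom 1 (des \<pi>) :: int poly) =
    (\<Sum>ps\<in>linear_extensions (P \<times> {1..n}) (prod_chain_rel r n).
      monom 1 (des (map (prod_labeling P w \<sigma>) ps)))"
    by (simp add: sum.reindex)
qed

lemma length_linear_extension:
  "ps \<in> linear_extensions Q r \<Longrightarrow> length ps = card Q"
  using distinct_card[of ps] by (simp add: linear_extensions_iff)

lemma coeff_C_poly_eq_0:
  assumes "labeling P w" "card P * n - 1 < i"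
  shows "coeff (C_poly P r w n) i = 0"
  unfolding C_poly_alt[OF assms(1)] coeff_sum
proof (intro sum.neutral ballI)
  fix \<sigma> ps assume "ps \<in> linear_extensions (P \<times> {1..n}) (prod_chain_rel r n)"
  then have "des (map (prod_labeling P w \<sigma>) ps) \<noteq> i"
    using des_le[of "map (prod_labeling P w \<sigma>) ps"] assms(2)
    by (simp add: length_linear_extension card_cartesian_product)
  then show "coeff (monom (1::int) (des (map (prod_labeling P w \<sigma>) ps))) i = 0" by simp
qed

text \<open>Matching \<open>\<sigma>\<close> with \<open>?\<rho> \<circ> \<sigma>\<close>
  complements every product label, so each extension exchanges its descents and ascents.\<close>

lemma coeff_C_poly_complement:
  assumes w: "labeling P w" and i: "i \<le> card P * n - 1"
  shows "coeff (C_poly P r (\<lambda>p. card P + 1 - w p) n) i = coeff (C_poly P r w n) (card P * n - 1 - i)"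
proof -
  let ?w = "\<lambda>p. card P + 1 - w p"
  let ?\<rho> = "\<lambda>i. if i \<in> {1..n} then n + 1 - i else i"
  let ?L = "linear_extensions (P \<times> {1..n}) (prod_chain_rel r n)"
  have eq: "des (map (prod_labeling P ?w (?\<rho> \<circ> \<sigma>)) ps) =
      card P * n - 1 - des (map (prod_labeling P w \<sigma>) ps)"
    if \<sigma>: "\<sigma> permutes {1..n}" and ps: "ps \<in> ?L" for \<sigma> ps
  proof -
    have set: "set ps = P \<times> {1..n}" "distinct ps" using ps by (simp_all add: linear_extensions_iff)
    have len: "length ps = card P * n" using ps by (simp add: length_linear_extension card_cartesian_product)
    have "distinct (map (prod_labeling P w \<sigma>) ps)"
      using inj_on_prod_labeling[OF w \<sigma>] set by (simp add: distinct_map)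
    moreover have "prod_labeling P ?w (?\<rho> \<circ> \<sigma>) x < prod_labeling P ?w (?\<rho> \<circ> \<sigma>) y \<longleftrightarrow>
        prod_labeling P w \<sigma> y < prod_labeling P w \<sigma> x" if "x \<in> set ps" "y \<in> set ps" for x y
    proof -
      have *: "prod_labeling P ?w (?\<rho> \<circ> \<sigma>) z + prod_labeling P w \<sigma> z = card P * n + 1"
        if "z \<in> set ps" for z
        using prod_labeling_complement[OF w \<sigma>, of "fst z" "snd z"] that set by auto
      show ?thesis using *[OF that(1)] *[OF that(2)] by linarith
    qed
    ultimately show ?thesis unfolding len[symmetric] by (rule des_map_antimono)
  qed
  have le: "des (map (prod_labeling P w \<sigma>) ps) \<le> card P * n - 1" if "ps \<in> ?L" for \<sigma> ps
    using des_le[of "map (prod_labeling P w \<sigma>) ps"] that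
    by (simp add: length_linear_extension card_cartesian_product)
  \<comment> \<open>Composition with the reversal permutes the index set of the outer sum.\<close>
  have C': "C_poly P r ?w n = (\<Sum>\<sigma> | \<sigma> permutes {1..n}. \<Sum>ps\<in>?L.
      monom 1 (des (map (prod_labeling P ?w (?\<rho> \<circ> \<sigma>)) ps)))"
    unfolding C_poly_alt[OF labeling_complement[OF w]]
    by (rule setum_permutations_compose_left[OF permutes_reversal])
  have "coeff (C_poly P r ?w n) i = (\<Sum>\<sigma> | \<sigma> permutes {1..n}. \<Sum>ps\<in>?L.
      coeff (monom 1 (des (map (prod_labeling P w \<sigma>) ps))) (card P * n - 1 - i))"
    unfolding C' coeff_sum
  proof (intro sum.cong refl)
    fix \<sigma> ps assume "\<sigma> \<in> {\<sigma>. \<sigma> permutes {1..n}}" and ps: "ps \<in> ?L"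
    then have "des (map (prod_labeling P ?w (?\<rho> \<circ> \<sigma>)) ps) = i \<longleftrightarrow>
        des (map (prod_labeling P w \<sigma>) ps) = card P * n - 1 - i"
      using eq[of \<sigma> ps] le[OF ps, of \<sigma>] i by auto
    then show "coeff (monom 1 (des (map (prod_labeling P ?w (?\<rho> \<circ> \<sigma>)) ps))) i =
        (coeff (monom 1 (des (map (prod_labeling P w \<sigma>) ps))) (card P * n - 1 - i) :: int)"
      by simp
  qed
  also have "\<dots> = coeff (C_poly P r w n) (card P * n - 1 - i)"
    by (simp only: C_poly_alt[OF w] coeff_sum)
  finally show ?thesis .
qed

text \<open>Reversing \<open>f\<close> at \<open>N\<close> gives \<open>f'\<close>, and both are
  shifts of the same \<open>g\<close>. Undoing the difference of the shifts turns the reversal into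
  a symmetry of \<open>f\<close> with \<open>d = N - k' + k\<close>.\<close>

lemma palindromic_if_reversal_shift:
  fixes f f' g :: "'a::comm_semiring_1 poly"
  assumes f: "f = monom 1 k * g" and f': "f' = monom 1 k' * g"
    and rev: "\<And>i. i \<le> N \<Longrightarrow> coeff f' i = coeff f (N - i)"
    and deg: "\<And>i. N < i \<Longrightarrow> coeff f i = 0" and k': "k' \<le> N"
  shows "palindromic f"
proof -
  have cf: "coeff f i = (if i < k then 0 else coeff g (i - k))" for i
    by (simp add: f coeff_monom_mult)
  have cf': "coeff f' i = (if i < k' then 0 else coeff g (i - k'))" for i
    by (simp add: f' coeff_monom_mult)
  \<comment> \<open>Reversal carries the \<open>k'\<close> vanishing low coefficients of
    \<open>f'\<close> to the top of \<open>f\<close>.\<close>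
  have high: "coeff f i = 0" if "N - k' < i" for i
  proof (cases "N < i")
    case False
    then have "N - i < k'" using that k' by linarith
    then show ?thesis using rev[of "N - i"] cf'[of "N - i"] False by simp
  qed (simp add: deg)
  have "coeff f i = coeff f (N - k' + k - i)" if "i \<le> N - k' + k" for i
  proof -
    \<comment> \<open>Outside the window from \<open>k\<close> to \<open>N - k'\<close> both
      coefficients vanish; inside it they are compared through \<open>f'\<close>.\<close>
    consider "i < k" | "N - k' < i" | "k \<le> i" "i \<le> N - k'" by linarith
    then show ?thesis
    proof cases
      case 1
      then show ?thesis using cf[of i] high[of "N - k' + k - i"] by simp
    next
      case 2
      then have "N - k' + k - i < k" using that by linarith
      then show ?thesis using high[OF 2] cf[of "N - k' + k - i"] by simp
    next
      case 3
      have "coeff f (N - k' + k - i) = coeff f' (k' + (i - k))"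
      proof -
        have "k' + (i - k) \<le> N" "N - (k' + (i - k)) = N - k' + k - i" using 3 k' by linarith+
        then show ?thesis using rev by metis
      qed
      then show ?thesis using cf[of i] cf'[of "k' + (i - k)"] 3 by simp
    qed
  qed
  moreover have "degree f \<le> N - k' + k"
    by (rule degree_le) (use high in auto)
  ultimately show ?thesis unfolding palindromic_def by blast
qed

text \<open>Each cover in the chain is a descent for exactly one of the two labelings, and the
  number of covers is the chain length.\<close>

lemma (in finite_poset) card_chain_descents_complement:
  assumes w: "labeling P w" and C: "maximal_chain r C" "C \<noteq> {}"
  shows "card (chain_descents r (\<lambda>p. card P + 1 - w p) C) =
    chain_length C - card (chain_descents r w C)"
proof -
  let ?w = "\<lambda>p. card P + 1 - w p"
  let ?S = "{(a, b). a \<in> C \<and> b \<in> C \<and> covers r a b}"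
  have "w b < w a \<longleftrightarrow> \<not> ?w b < ?w a" if "a \<in> C" "b \<in> C" "covers r a b" for a b
  proof -
    have ab: "a \<in> P" "b \<in> P" "a \<noteq> b"
      using that maximal_chain_subset[OF C(1)] by (auto simp: covers_def)
    then have "w a \<noteq> w b" "w a \<le> card P" "w b \<le> card P"
      using w by (auto simp: labeling_def bij_betw_def dest: inj_onD)
    then show ?thesis by auto
  qed
  then have "chain_descents r ?w C = ?S - chain_descents r w C"
    by (auto simp: chain_descents_def)
  moreover have "chain_descents r w C \<subseteq> ?S" by (auto simp: chain_descents_def)
  ultimately show ?thesis
    using card_covers_maximal_chain[OF C] finite_chain_descents[of w C]
    by (simp add: card_Diff_subset chain_length_def)
qed

theorem theorem3p5:
  fixes P :: "'a set" and r :: "'a rel" and w :: "'a \<Rightarrow> nat" and k :: nat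
  assumes "finite P" and "P \<noteq> {}" and "partial_order_on P r"
    and "labeling P w"
    and "\<And>C. maximal_chain r C \<Longrightarrow> card (chain_descents r w C) = k"
  shows "\<forall>n \<ge> 1.
           C_poly P r w n =
             monom 1 k * A_poly n * hstar_natural (P \<times> {1..n}) (prod_chain_rel r n) \<and>
           (graded r \<longrightarrow> palindromic (C_poly P r w n))"
proof (intro allI impI conjI)
  interpret finite_poset P r using assms(1,3) by unfold_locales
  fix n :: nat assume n: "n \<ge> 1"
  let ?g = "A_poly n * hstar_natural (P \<times> {1..n}) (prod_chain_rel r n)"
  have C: "C_poly P r w n = monom 1 k * A_poly n * hstar_natural (P \<times> {1..n}) (prod_chain_rel r n)"
    using C_poly_eq[OF assms(2,4) n assms(5)] by simp
  then show "C_poly P r w n =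
    monom 1 k * A_poly n * hstar_natural (P \<times> {1..n}) (prod_chain_rel r n)" .
  assume "graded r"
  then obtain l where l: "\<And>C. maximal_chain r C \<Longrightarrow> chain_length C = l"
    unfolding graded_def by blast
  let ?w = "\<lambda>p. card P + 1 - w p"
  \<comment> \<open>A concrete maximal chain bounds \<open>l\<close> by \<open>card P - 1\<close>,
    so the shift \<open>l - k\<close> does not exceed the reversal length
    \<open>card P * n - 1\<close>.\<close>
  obtain p where p: "p \<in> P" using assms(2) by blast
  have "{p} \<in> Chains r" using rel_refl[OF p] by (simp add: Chains_def)
  then obtain D where D: "maximal_chain r D" using ex_maximal_chain by blast
  have "card D \<le> card P" using maximal_chain_subset[OF D] assms(1) by (rule card_mono[rotated])
  then have "l \<le> card P - 1" using l[OF D] by (simp add: chain_length_def)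
  also have "\<dots> \<le> card P * n - 1" using n by (intro diff_le_mono) simp
  finally have le: "l - k \<le> card P * n - 1" by simp
  have "card (chain_descents r ?w C) = l - k" if C: "maximal_chain r C" for C
  proof -
    \<comment> \<open>The empty chain is not maximal, since \<open>{p}\<close> extends it.\<close>
    have "C \<noteq> {}"
      using maximal_chain_memI[OF C p] by blast
    then show ?thesis
      using card_chain_descents_complement[OF assms(4) C] l[OF C] assms(5)[OF C] by simp
  qed
  then have C': "C_poly P r ?w n =
      monom 1 (l - k) * A_poly n * hstar_natural (P \<times> {1..n}) (prod_chain_rel r n)"
    using C_poly_eq[OF assms(2) labeling_complement[OF assms(4)] n] by blast
  show "palindromic (C_poly P r w n)"
  proof (rule palindromic_if_reversal_shift)
    show "C_poly P r w n = monom 1 k * ?g" using C by (simp only: mult.assoc)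
    show "C_poly P r ?w n = monom 1 (l - k) * ?g" using C' by (simp only: mult.assoc)
  qed (use le coeff_C_poly_complement[OF assms(4)] coeff_C_poly_eq_0[OF assms(4)] in blast)+
qed

end
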